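(* Let $\Lambda$ be a finite measure on $[0,1]$ with $\Lambda(\{1\})=0$ and let $\nu(dx)=x^{-2}\Lambda(dx)$ (with the convention $1/0=\infty$). Suppose $\nu(\{0,1\})=0$, $\int_0^1x\,\nu(dx)<\infty$ and $\nu([0,1])=\infty$. Let $(\Pi_t)_{t\ge0}$ be the $\Lambda$-coalescent and let $N^a_t=|\{b\in\Pi_t:\mathrm{freq}(b)>0\}|$. Then for every fixed $t>0$, $\mathbb{P}[N^a_t=\infty]=1$.
   Context: For $n\in\mathbb{N}$, let $\iota_n$ be the restriction map from partitions of $\mathbb{N}$ to partitions of $\{1,\dots,n\}$. The $\Lambda$-coalescent is the Markov process $(\Pi_t)_{t\ge 0}$ with values in partitions of $\mathbb{N}$, started from the partition into singletons, such that for every $n$, $\iota_n(\Pi_t)$ is a Markov chain in which, whenever it has $i$ blocks, each particular $k$-tuple of blocks merges at rate $\lambda_{i,k}=\int_0^1x^{k-2}(1-x)^{i-k}\Lambda(dx)$, independently of other $k$-tuples. For $t>0$, $\Pi_t$ is exchangeable, so almost surely each block $b$ has asymptotic frequency $\mathrm{freq}(b)=\lim_{k\to\infty}|b\cap\{1,\dots,k\}|/k$. *)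

theory Defs
  imports "HOL-Probability.Probability"
begin

definition parts :: "nat \<Rightarrow> nat set set set" where
  "parts n = {P. partition_on {1..n} P}"

definition iota :: "nat \<Rightarrow> nat set set \<Rightarrow> nat set set" where
  "iota n P = {b \<inter> {1..n} | b. b \<in> P \<and> b \<inter> {1..n} \<noteq> {}}"

definition singletons :: "nat \<Rightarrow> nat set set" where
  "singletons n = {{i} | i. i \<in> {1..n}}"

definition merge :: "nat set set \<Rightarrow> nat set set \<Rightarrow> nat set set" where
  "merge P B = insert (\<Union>B) (P - B)"

definition lam :: "real measure \<Rightarrow> nat \<Rightarrow> nat \<Rightarrow> real" where
  "lam \<Lambda> i k = (\<integral>x. x ^ (k - 2) * (1 - x) ^ (i - k) \<partial>\<Lambda>)"

definition Qoff :: "real measure \<Rightarrow> nat set set \<Rightarrow> nat set set \<Rightarrow> real" where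
  "Qoff \<Lambda> p q = (\<Sum>B\<in>{B. B \<subseteq> p \<and> card B \<ge> 2 \<and> merge p B = q}. lam \<Lambda> (card p) (card B))"

definition Qgen :: "real measure \<Rightarrow> nat \<Rightarrow> nat set set \<Rightarrow> nat set set \<Rightarrow> real" where
  "Qgen \<Lambda> n p q = (if p = q then - (\<Sum>r\<in>parts n - {p}. Qoff \<Lambda> p r) else Qoff \<Lambda> p q)"

fun Qpow :: "real measure \<Rightarrow> nat \<Rightarrow> nat \<Rightarrow> nat set set \<Rightarrow> nat set set \<Rightarrow> real" where
  "Qpow \<Lambda> n 0 p q = (if p = q then 1 else 0)"
| "Qpow \<Lambda> n (Suc m) p q = (\<Sum>r\<in>parts n. Qpow \<Lambda> n m p r * Qgen \<Lambda> n r q)"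

definition Ptrans :: "real measure \<Rightarrow> nat \<Rightarrow> real \<Rightarrow> nat set set \<Rightarrow> nat set set \<Rightarrow> real" where
  "Ptrans \<Lambda> n t p q = (\<Sum>m. t ^ m / fact m * Qpow \<Lambda> n m p q)"

text \<open>Pt is a Lambda-coalescent on the probability space M: it takes values in partitions of N,
  each restriction is measurable, and for every n the restriction iota_n(Pi_t) has the
  finite-dimensional distributions of the continuous-time Markov chain with generator Qgen
  started from the partition into singletons.\<close>
definition is_Lambda_coalescent ::
    "real measure \<Rightarrow> 'a measure \<Rightarrow> (real \<Rightarrow> 'a \<Rightarrow> nat set set) \<Rightarrow> bool" where
  "is_Lambda_coalescent \<Lambda> M Pt \<longleftrightarrow>
     (\<forall>t\<ge>0. \<forall>\<omega>\<in>space M. partition_on {1..} (Pt t \<omega>)) \<and>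
     (\<forall>n\<ge>1. \<forall>t\<ge>0. (\<lambda>\<omega>. iota n (Pt t \<omega>)) \<in> measurable M (count_space UNIV)) \<and>
     (\<forall>n\<ge>1. \<forall>ts ps. sorted ts \<longrightarrow> (\<forall>t\<in>set ts. t \<ge> 0) \<longrightarrow> length ps = length ts \<longrightarrow>
        measure M {\<omega>\<in>space M. \<forall>j<length ts. iota n (Pt (ts ! j) \<omega>) = ps ! j}
        = (\<Prod>j<length ts. Ptrans \<Lambda> n (ts ! j - (0 # ts) ! j) ((singletons n # ps) ! j) (ps ! j)))"

definition has_pos_freq :: "nat set \<Rightarrow> bool" where
  "has_pos_freq b \<longleftrightarrow> (\<exists>f>0. (\<lambda>k. real (card (b \<inter> {1..k})) / real k) \<longlonglongrightarrow> f)"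

definition Na :: "(real \<Rightarrow> 'a \<Rightarrow> nat set set) \<Rightarrow> real \<Rightarrow> 'a \<Rightarrow> enat" where
  "Na Pt t \<omega> = (let S = {b \<in> Pt t \<omega>. has_pos_freq b} in if finite S then enat (card S) else \<infinity>)"

definition nu :: "real measure \<Rightarrow> real measure" where
  "nu \<Lambda> = density \<Lambda> (\<lambda>x. if x = 0 then \<infinity> else ennreal (1 / x ^ 2))"

end

theory Submission
  imports Defs "HOL-Real_Asymp.Real_Asymp"
begin

text \<open>The number of non-singleton blocks of \<open>iota n (Pt t \<omega>)\<close> increases with \<open>n\<close>, so it tends to
  infinity almost surely as soon as the probability that the finite chain has fewer than \<open>K\<close> such blocks
  at time \<open>t\<close> tends to \<open>0\<close>. Two Lyapunov functions of the finite chain give this. Writing \<open>s\<close> for the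
  number of singletons and \<open>d\<close> for the number of other blocks, \<open>ln (1 + n) - ln (1 + s)\<close> has drift at
  most \<open>C / \<delta> + \<nu>((1 - \<delta>, 1)) ln (1 + n)\<close>, so \<open>s\<close> is large with high probability. The deficit
  \<open>max 0 (K - d)\<close> grows at rate at most \<open>K \<integral> x \<nu>(dx)\<close>, because each non-singleton block takes part in
  mergers at that finite rate, while it decreases at a rate that is unbounded as \<open>s\<close> grows, because
  \<open>\<nu>\<close> is infinite and every merger of singletons only creates a new block.

  By exchangeability the indicators of belonging to the block of \<open>i\<close> have almost surely convergent
  averages, and if the limit is \<open>0\<close> then the block is \<open>{i}\<close>. Hence the infinitely many non-singleton
  blocks all have positive frequency.\<close>

section \<open>Random subsets\<close>

text \<open>\<open>bw x A B\<close> is the probability that \<open>B\<close> is the random subset of \<open>A\<close> obtained by keeping each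
  element independently with probability \<open>x\<close>; for \<open>A\<close> the set of blocks, it is the probability that a
  merger of size \<open>x\<close> involves exactly the blocks in \<open>B\<close>.\<close>

definition bw :: "real \<Rightarrow> 'b set \<Rightarrow> 'b set \<Rightarrow> real" where
  "bw x A B = x ^ card B * (1 - x) ^ (card A - card B)"

lemma bw_nonneg: "0 \<le> x \<Longrightarrow> x \<le> 1 \<Longrightarrow> 0 \<le> bw x A B"
  by (simp add: bw_def)

lemma sum_Pow_bw_insert:
  assumes "finite A" "a \<notin> A"
  shows "(\<Sum>B\<in>Pow (insert a A). bw x (insert a A) B * g B) =
    (1 - x) * (\<Sum>B\<in>Pow A. bw x A B * g B) + x * (\<Sum>B\<in>Pow A. bw x A B * g (insert a B))"
proof -
  have inj: "inj_on (insert a) (Pow A)"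
    using assms by (auto simp: inj_on_def)
  have disj: "Pow A \<inter> insert a ` Pow A = {}"
    using assms by auto
  have 1: "bw x (insert a A) B = (1 - x) * bw x A B" if "B \<in> Pow A" for B
  proof -
    have "card B \<le> card A" using that assms by (auto intro: card_mono)
    thus ?thesis using assms by (simp add: bw_def Suc_diff_le)
  qed
  have 2: "bw x (insert a A) (insert a B) = x * bw x A B" if "B \<in> Pow A" for B
  proof -
    have "a \<notin> B" "finite B" using that assms by (auto intro: finite_subset)
    thus ?thesis using assms by (simp add: bw_def)
  qed
  show ?thesis
    unfolding Pow_insert using assms(1) disj inj
    by (simp add: sum.union_disjoint sum.reindex sum_distrib_left 1 2 mult.assoc[symmetric]
        del: Pow_iff cong: sum.cong)
qed

lemma sum_Pow_bw: "finite A \<Longrightarrow> (\<Sum>B\<in>Pow A. bw x A B) = 1"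
proof (induction A rule: finite_induct)
  case (insert a A)
  thus ?case using sum_Pow_bw_insert[of A a x "\<lambda>_. 1"] by simp
qed (simp add: bw_def)

lemma sum_Pow_bw_marginal:
  assumes "finite A" "finite C" "A \<inter> C = {}"
  shows "(\<Sum>B\<in>Pow (C \<union> A). bw x (C \<union> A) B * g (B \<inter> A)) = (\<Sum>B\<in>Pow A. bw x A B * g B)"
  using assms(2,3)
proof (induction C rule: finite_induct)
  case empty
  show ?case by (auto intro!: sum.cong simp: Int_absorb2)
next
  case (insert a C)
  thus ?case using sum_Pow_bw_insert[of "C \<union> A" a x "\<lambda>B. g (B \<inter> A)"] assms(1)
    by (simp add: algebra_simps)
qed

lemma sum_Pow_bw_card: "finite A \<Longrightarrow> (\<Sum>B\<in>Pow A. bw x A B * card B) = x * card A"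
proof (induction A rule: finite_induct)
  case (insert a A)
  have "(\<Sum>B\<in>Pow A. bw x A B * card (insert a B)) = (\<Sum>B\<in>Pow A. bw x A B * card B + bw x A B)"
    using insert.hyps by (intro sum.cong refl) (auto simp: finite_subset card_insert_if algebra_simps)
  also have "\<dots> = x * card A + 1"
    using insert by (simp add: sum.distrib sum_Pow_bw)
  finally show ?case using insert sum_Pow_bw_insert[of A a x card]
    by (simp add: algebra_simps)
qed (simp add: bw_def)

lemma sum_Pow_card:
  fixes F :: "nat \<Rightarrow> real"
  assumes "finite A"
  shows "(\<Sum>B\<in>Pow A. F (card B)) = (\<Sum>k\<le>card A. (card A choose k) * F k)"
proof -
  have "(\<Sum>B\<in>Pow A. F (card B)) = (\<Sum>k\<le>card A. \<Sum>B\<in>{B \<in> Pow A. card B = k}. F (card B))"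
    using assms by (intro sum.group[symmetric]) (auto intro: card_mono)
  also have "\<dots> = (\<Sum>k\<le>card A. (card A choose k) * F k)"
    using assms by (intro sum.cong refl) (simp add: n_subsets)
  finally show ?thesis .
qed

lemma sum_Pow_bw_recip:
  fixes x :: real
  assumes "finite A" "0 \<le> x" "x < 1"
  shows "(\<Sum>B\<in>Pow A. bw x A B * (1 / (1 + real (card A - card B)))) \<le> 1 / ((1 + real (card A)) * (1 - x))"
proof -
  define s where "s = card A"
  have "(\<Sum>B\<in>Pow A. bw x A B * (1 / (1 + real (card A - card B))))
      = (\<Sum>k\<le>s. (s choose k) * (x ^ k * (1 - x) ^ (s - k) * (1 / (1 + real (s - k)))))"
    unfolding bw_def s_def
    using sum_Pow_card[OF assms(1), of "\<lambda>k. x ^ k * (1 - x) ^ (card A - k) * (1 / (1 + real (card A - k)))"]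
    by simp
  also have "\<dots> = (\<Sum>k\<le>s. (Suc s choose k) * x ^ k * (1 - x) ^ (Suc s - k)) * (1 / ((1 + real s) * (1 - x)))"
    unfolding sum_distrib_right
  proof (intro sum.cong refl)
    fix k assume "k \<in> {..s}"
    hence k: "k \<le> s" by simp
    have "Suc (s - k) * (Suc s choose k) = Suc s * (s choose k)"
      using k binomial_absorb_comp[of "Suc s" k] by (simp add: Suc_diff_le)
    hence "real (Suc (s - k)) * real (Suc s choose k) = real (Suc s) * real (s choose k)"
      by (metis of_nat_mult)
    hence *: "real (s choose k) = real (Suc (s - k)) * real (Suc s choose k) / real (Suc s)"
      by (simp add: field_simps)
    have "Suc s - k = Suc (s - k)" using k by simp
    thus "real (s choose k) * (x ^ k * (1 - x) ^ (s - k) * (1 / (1 + real (s - k))))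
      = real (Suc s choose k) * x ^ k * (1 - x) ^ (Suc s - k) * (1 / ((1 + real s) * (1 - x)))"
      using assms(3) unfolding * by (simp add: divide_simps)
  qed
  also have "(\<Sum>k\<le>s. (Suc s choose k) * x ^ k * (1 - x) ^ (Suc s - k)) \<le>
      (\<Sum>k\<le>Suc s. (Suc s choose k) * x ^ k * (1 - x) ^ (Suc s - k))"
    using assms by (intro sum_mono2) auto
  also have "\<dots> = 1"
    using binomial_ring[of x "1 - x" "Suc s"] by simp
  finally show ?thesis
    using assms(3) unfolding s_def by (simp add: mult_right_mono divide_right_mono)
qed

lemma sum_Pow_bw_ge2:
  fixes x :: real
  assumes "finite A"
  shows "(\<Sum>B\<in>{B \<in> Pow A. 2 \<le> card B}. bw x A B) =
    1 - (1 - x) ^ card A - card A * x * (1 - x) ^ (card A - 1)"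
proof -
  have "(\<Sum>B\<in>{B \<in> Pow A. \<not> 2 \<le> card B}. bw x A B) = 
     (\<Sum>B\<in>Pow A. if card B < 2 then x ^ card B * (1 - x) ^ (card A - card B) else 0)"
    using assms by (subst sum.inter_filter) (auto simp: bw_def not_le intro!: sum.cong)
  also have "\<dots> = (\<Sum>k\<le>card A. (card A choose k) * (if k < 2 then x ^ k * (1 - x) ^ (card A - k) else 0))"
    by (rule sum_Pow_card[OF assms])
  also have "\<dots> = (\<Sum>k\<in>{0,1}. (card A choose k) * (x ^ k * (1 - x) ^ (card A - k)))"
    by (rule sum.mono_neutral_cong) (auto simp: binomial_eq_0)
  finally have 1: "(\<Sum>B\<in>{B \<in> Pow A. \<not> 2 \<le> card B}. bw x A B) =
      (1 - x) ^ card A + card A * x * (1 - x) ^ (card A - 1)" by simp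
  have "(\<Sum>B\<in>Pow A. bw x A B) = (\<Sum>B\<in>{B \<in> Pow A. 2 \<le> card B}. bw x A B)
     + (\<Sum>B\<in>{B \<in> Pow A. \<not> 2 \<le> card B}. bw x A B)"
    using assms by (subst sum.union_disjoint[symmetric]) (auto intro!: sum.cong)
  thus ?thesis using 1 sum_Pow_bw[OF assms, of x] by simp
qed

section \<open>The finite chains\<close>

lemma finite_parts: "finite (parts n)"
proof (rule finite_subset)
  show "parts n \<subseteq> Pow (Pow {1..n})" by (force simp: parts_def partition_on_def)
qed simp

lemma singletons_in_parts: "singletons n \<in> parts n"
proof -
  have "\<Union>(singletons n) = {1..n}" by (force simp: singletons_def)
  thus ?thesis unfolding parts_def partition_on_def disjoint_def by (auto simp: singletons_def)
qed

lemma Qpow_bound: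
  assumes "q \<in> parts n"
  shows "\<bar>Qpow \<Lambda> n m p q\<bar> \<le> (\<Sum>q\<in>parts n. \<Sum>r\<in>parts n. \<bar>Qgen \<Lambda> n r q\<bar>) ^ m"
  using assms
proof (induction m arbitrary: q)
  case (Suc m)
  let ?A = "\<Sum>q\<in>parts n. \<Sum>r\<in>parts n. \<bar>Qgen \<Lambda> n r q\<bar>"
  have "\<bar>Qpow \<Lambda> n (Suc m) p q\<bar> \<le> (\<Sum>r\<in>parts n. \<bar>Qpow \<Lambda> n m p r\<bar> * \<bar>Qgen \<Lambda> n r q\<bar>)"
    by (simp add: sum_abs abs_mult[symmetric])
  also have "\<dots> \<le> (\<Sum>r\<in>parts n. ?A ^ m * \<bar>Qgen \<Lambda> n r q\<bar>)"
    by (intro sum_mono mult_right_mono Suc.IH) auto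
  also have "\<dots> = ?A ^ m * (\<Sum>r\<in>parts n. \<bar>Qgen \<Lambda> n r q\<bar>)"
    by (simp add: sum_distrib_left)
  also have "\<dots> \<le> ?A ^ m * ?A"
    using Suc.prems by (intro mult_left_mono member_le_sum zero_le_power sum_nonneg finite_parts) auto
  finally show ?case by (simp add: mult.commute)
qed auto

lemma Ptrans_summable:
  assumes "q \<in> parts n"
  shows "summable (\<lambda>m. Qpow \<Lambda> n m p q / fact m * t ^ m)"
proof -
  let ?A = "\<Sum>q\<in>parts n. \<Sum>r\<in>parts n. \<bar>Qgen \<Lambda> n r q\<bar>"
  show ?thesis
  proof (rule summable_comparison_test'[where N = 0])
    show "summable (\<lambda>m. inverse (fact m) * (?A * \<bar>t\<bar>) ^ m)" by (rule summable_exp)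
    fix m :: nat
    show "norm (Qpow \<Lambda> n m p q / fact m * t ^ m) \<le> inverse (fact m) * (?A * \<bar>t\<bar>) ^ m"
      using mult_right_mono[OF Qpow_bound[OF assms, of \<Lambda> m p], of "\<bar>t\<bar> ^ m / fact m"]
      by (simp add: abs_mult power_mult_distrib power_abs field_simps)
  qed
qed

lemma Ptrans_has_derivative:
  assumes "q \<in> parts n"
  shows "((\<lambda>t. Ptrans \<Lambda> n t p q) has_real_derivative
    (\<Sum>r\<in>parts n. Ptrans \<Lambda> n t p r * Qgen \<Lambda> n r q)) (at t)"
proof -
  define c where "c = (\<lambda>r m. Qpow \<Lambda> n m p r / fact m)"
  have P: "Ptrans \<Lambda> n t p r = (\<Sum>m. c r m * t ^ m)" for r t
    unfolding Ptrans_def c_def by (simp add: field_simps)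
  have sm: "summable (\<lambda>m. c r m * t ^ m)" if "r \<in> parts n" for r t
    unfolding c_def by (rule Ptrans_summable[OF that])
  have d: "diffs (c q) m = (\<Sum>r\<in>parts n. c r m * Qgen \<Lambda> n r q)" for m
    unfolding diffs_def c_def by (simp add: sum_distrib_left sum_divide_distrib field_simps del: of_nat_Suc)
  have "((\<lambda>t. \<Sum>m. c q m * t ^ m) has_real_derivative (\<Sum>m. diffs (c q) m * t ^ m)) (at t)"
    by (rule termdiffs_strong_converges_everywhere) (rule sm[OF assms])
  moreover have "(\<Sum>m. diffs (c q) m * t ^ m) = (\<Sum>m. \<Sum>r\<in>parts n. c r m * t ^ m * Qgen \<Lambda> n r q)"
    unfolding d sum_distrib_right by (simp add: mult_ac)
  moreover have "\<dots> = (\<Sum>r\<in>parts n. \<Sum>m. c r m * t ^ m * Qgen \<Lambda> n r q)"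
    by (intro suminf_sum summable_mult2 sm)
  moreover have "\<dots> = (\<Sum>r\<in>parts n. (\<Sum>m. c r m * t ^ m) * Qgen \<Lambda> n r q)"
    by (intro sum.cong refl suminf_mult2[symmetric] sm)
  ultimately show ?thesis by (simp add: P)
qed

lemma Ptrans_0: "Ptrans \<Lambda> n 0 p q = (if p = q then 1 else 0)"
proof -
  have "(\<lambda>m. 0 ^ m / fact m * Qpow \<Lambda> n m p q) = (\<lambda>m. (Qpow \<Lambda> n m p q / fact m) * 0 ^ m)"
    by (simp add: field_simps)
  thus ?thesis unfolding Ptrans_def using powser_zero[of "\<lambda>m. Qpow \<Lambda> n m p q / fact m"] by simp
qed

definition Gen :: "real measure \<Rightarrow> (nat set set \<Rightarrow> real) \<Rightarrow> nat set set \<Rightarrow> real" where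
  "Gen \<Lambda> f p = (\<Sum>B\<in>{B \<in> Pow p. 2 \<le> card B}. lam \<Lambda> (card p) (card B) * (f (merge p B) - f p))"

lemma finite_part:
  assumes "p \<in> parts n"
  shows "finite p" "b \<in> p \<Longrightarrow> finite b"
proof -
  have "p \<subseteq> Pow {1..n}" using assms by (auto simp: parts_def partition_on_def)
  thus "finite p" "b \<in> p \<Longrightarrow> finite b" by (auto intro: finite_subset)
qed

lemma merge_in_parts:
  assumes "p \<in> parts n" "B \<subseteq> p" "B \<noteq> {}"
  shows "merge p B \<in> parts n"
proof -
  have p: "\<Union>p = {1..n}" "{} \<notin> p" "\<And>a b. a \<in> p \<Longrightarrow> b \<in> p \<Longrightarrow> a \<noteq> b \<Longrightarrow> a \<inter> b = {}"
    using assms(1) by (auto simp: parts_def partition_on_def disjoint_def)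
  have "\<Union>(merge p B) = {1..n}" unfolding merge_def p(1)[symmetric] using assms(2) by blast
  moreover obtain b where "b \<in> B" "b \<noteq> {}" using p(2) assms(2,3) by blast
  hence "\<Union>B \<noteq> {}" by blast
  hence "{} \<notin> merge p B" unfolding merge_def using p(2) by auto
  moreover have "disjoint (merge p B)"
    unfolding disjoint_def merge_def using p(3) assms(2) by fast
  ultimately show ?thesis by (simp add: parts_def partition_on_def)
qed

lemma sum_Qgen:
  assumes "p \<in> parts n"
  shows "(\<Sum>q\<in>parts n. Qgen \<Lambda> n p q * f q) = Gen \<Lambda> f p"
proof -
  let ?S = "{B \<in> Pow p. 2 \<le> card B}"
  have fin: "finite ?S" using finite_part[OF assms] by auto
  have "(\<Sum>q\<in>parts n. Qgen \<Lambda> n p q * f q)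
     = Qgen \<Lambda> n p p * f p + (\<Sum>q\<in>parts n - {p}. Qgen \<Lambda> n p q * f q)"
    using assms by (simp add: sum.remove finite_parts)
  also have "\<dots> = (\<Sum>q\<in>parts n - {p}. Qoff \<Lambda> p q * (f q - f p))"
  proof -
    have "Qgen \<Lambda> n p q * f q = Qoff \<Lambda> p q * f q" if "q \<in> parts n - {p}" for q
      using that by (auto simp: Qgen_def)
    hence "(\<Sum>q\<in>parts n - {p}. Qgen \<Lambda> n p q * f q) = (\<Sum>q\<in>parts n - {p}. Qoff \<Lambda> p q * f q)"
      by (rule sum.cong[OF refl])
    thus ?thesis
      by (simp add: Qgen_def[of _ _ p p] sum_distrib_right right_diff_distrib sum_subtractf)
  qed
  also have "\<dots> = (\<Sum>q\<in>parts n. Qoff \<Lambda> p q * (f q - f p))"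
    using assms by (simp add: sum.remove finite_parts)
  also have "\<dots> = (\<Sum>q\<in>parts n. \<Sum>B\<in>{B \<in> ?S. merge p B = q}. lam \<Lambda> (card p) (card B) * (f (merge p B) - f p))"
    unfolding Qoff_def sum_distrib_right by (intro sum.cong refl) auto
  also have "\<dots> = Gen \<Lambda> f p"
    unfolding Gen_def
  proof (intro sum.group finite_parts fin subsetI)
    fix q assume "q \<in> merge p ` ?S"
    then obtain B where "q = merge p B" "B \<subseteq> p" "2 \<le> card B" by blast
    moreover from this have "B \<noteq> {}" by auto
    ultimately show "q \<in> parts n" using merge_in_parts[OF assms] by simp
  qed
  finally show ?thesis .
qed

lemma sum_Ptrans_has_derivative:
  "((\<lambda>t. \<Sum>q\<in>parts n. Ptrans \<Lambda> n t p q * f q) has_real_derivative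
    (\<Sum>q\<in>parts n. Ptrans \<Lambda> n t p q * Gen \<Lambda> f q)) (at t)"
proof -
  have "((\<lambda>t. \<Sum>q\<in>parts n. Ptrans \<Lambda> n t p q * f q) has_real_derivative
    (\<Sum>q\<in>parts n. (\<Sum>r\<in>parts n. Ptrans \<Lambda> n t p r * Qgen \<Lambda> n r q) * f q)) (at t)"
    by (intro DERIV_sum DERIV_cmult_right Ptrans_has_derivative)
  also have "(\<Sum>q\<in>parts n. (\<Sum>r\<in>parts n. Ptrans \<Lambda> n t p r * Qgen \<Lambda> n r q) * f q)
     = (\<Sum>r\<in>parts n. Ptrans \<Lambda> n t p r * (\<Sum>q\<in>parts n. Qgen \<Lambda> n r q * f q))"
    unfolding sum_distrib_right sum_distrib_left by (subst sum.swap) (simp add: mult.assoc)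
  also have "\<dots> = (\<Sum>q\<in>parts n. Ptrans \<Lambda> n t p q * Gen \<Lambda> f q)"
    by (intro sum.cong refl) (simp add: sum_Qgen)
  finally show ?thesis .
qed

definition sing :: "nat set set \<Rightarrow> nat set set" where
  "sing p = {b \<in> p. card b = 1}"

definition nons :: "nat set set \<Rightarrow> nat set set" where
  "nons p = {b \<in> p. card b \<noteq> 1}"

lemma sing_nons: "p = nons p \<union> sing p" "sing p \<inter> nons p = {}"
  by (auto simp: sing_def nons_def)

lemma finite_sing_nons: "p \<in> parts n \<Longrightarrow> finite (sing p)" "p \<in> parts n \<Longrightarrow> finite (nons p)"
  using finite_part by (auto simp: sing_def nons_def)

lemma card_sing_le: 
  assumes "p \<in> parts n"
  shows "card (sing p) \<le> n"
proof -
  have "sing p \<subseteq> (\<lambda>i. {i}) ` {1..n}"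
  proof
    fix b assume b: "b \<in> sing p"
    then obtain i where i: "b = {i}" by (auto simp: sing_def card_1_singleton_iff)
    have "b \<subseteq> {1..n}" using assms b by (auto simp: sing_def parts_def partition_on_def)
    thus "b \<in> (\<lambda>i. {i}) ` {1..n}" using i by auto
  qed
  hence "card (sing p) \<le> card ((\<lambda>i. {i}) ` {1..n})" by (intro card_mono) auto
  also have "\<dots> \<le> n" using card_image_le[of "{1..n}" "\<lambda>i. {i}"] by simp
  finally show ?thesis .
qed

lemma card_sing_singletons: "card (sing (singletons n)) = n"
proof -
  have "sing (singletons n) = (\<lambda>i. {i}) ` {1..n}" by (auto simp: sing_def singletons_def)
  thus ?thesis by (simp add: card_image)
qed

lemma sing_nons_merge:
  assumes "p \<in> parts n" "B \<subseteq> p" "2 \<le> card B"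
  shows "sing (merge p B) = sing p - B" "nons (merge p B) = insert (\<Union>B) (nons p - B)"
    "\<Union>B \<notin> nons p - B"
proof -
  have p: "{} \<notin> p" "\<And>a b. a \<in> p \<Longrightarrow> b \<in> p \<Longrightarrow> a \<noteq> b \<Longrightarrow> a \<inter> b = {}"
    using assms(1) by (auto simp: parts_def partition_on_def disjoint_def)
  have c: "card (\<Union>B) \<noteq> 1"
  proof
    assume "card (\<Union>B) = 1"
    then obtain z where z: "\<Union>B = {z}" by (auto simp: card_1_singleton_iff)
    have "B \<subseteq> {{z}}"
    proof
      fix b assume "b \<in> B"
      hence "b \<noteq> {}" "b \<subseteq> {z}" using z p(1) assms(2) by auto
      thus "b \<in> {{z}}" by auto
    qed
    hence "card B \<le> 1" using card_mono[of "{{z}}" B] by simp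
    thus False using assms(3) by simp
  qed
  show "sing (merge p B) = sing p - B" "nons (merge p B) = insert (\<Union>B) (nons p - B)"
    using c by (auto simp: sing_def nons_def merge_def)
  show "\<Union>B \<notin> nons p - B"
  proof
    assume *: "\<Union>B \<in> nons p - B"
    obtain b where b: "b \<in> B" using assms(3) by fastforce
    hence "b \<inter> \<Union>B = {}" using p(2)[of b "\<Union>B"] * assms(2) by (auto simp: nons_def)
    hence "b = {}" using b by blast
    thus False using b p(1) assms(2) by blast
  qed
qed

lemma card_sing_merge:
  assumes "p \<in> parts n" "B \<subseteq> p" "2 \<le> card B"
  shows "card (sing (merge p B)) = card (sing p) - card (B \<inter> sing p)"
  using sing_nons_merge[OF assms] finite_sing_nons[OF assms(1)]
  by (simp add: card_Diff_subset_Int Int_commute)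

lemma card_nons_merge:
  assumes "p \<in> parts n" "B \<subseteq> p" "2 \<le> card B"
  shows "card (nons (merge p B)) = Suc (card (nons p) - card (B \<inter> nons p))"
  using sing_nons_merge[OF assms] finite_sing_nons[OF assms(1)]
  by (simp add: card_Diff_subset_Int Int_commute)

lemma iota_in_parts:
  assumes "partition_on {1..} P"
  shows "iota n P \<in> parts n"
proof -
  have p: "\<Union>P = {1..}" "\<And>a b. a \<in> P \<Longrightarrow> b \<in> P \<Longrightarrow> a \<noteq> b \<Longrightarrow> a \<inter> b = {}"
    using assms by (auto simp: partition_on_def disjoint_def)
  have "\<Union>(iota n P) = \<Union>P \<inter> {1..n}" by (auto simp: iota_def)
  hence "\<Union>(iota n P) = {1..n}" using p(1) by auto
  moreover have "disjoint (iota n P)"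
  proof (rule disjointI)
    fix a b assume "a \<in> iota n P" "b \<in> iota n P" "a \<noteq> b"
    then obtain a' b' where "a = a' \<inter> {1..n}" "b = b' \<inter> {1..n}" "a' \<in> P" "b' \<in> P" "a' \<noteq> b'"
      by (auto simp: iota_def)
    thus "a \<inter> b = {}" using p(2)[of a' b'] by auto
  qed
  moreover have "{} \<notin> iota n P" by (auto simp: iota_def)
  ultimately show ?thesis by (simp add: parts_def partition_on_def)
qed

section \<open>Drift estimates\<close>

locale dust_measure =
  fixes \<Lambda> :: "real measure"
  assumes finite_measure_Lambda: "finite_measure \<Lambda>"
    and sets_Lambda [measurable_cong]: "sets \<Lambda> = sets borel"
    and Lambda_outside: "emeasure \<Lambda> (UNIV - {0..1}) = 0"
    and nu_01: "emeasure (nu \<Lambda>) {0, 1} = 0"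
    and nu_mean: "(\<integral>\<^sup>+ x. ennreal x \<partial>nu \<Lambda>) < \<infinity>"
    and nu_infinite: "emeasure (nu \<Lambda>) {0..1} = \<infinity>"

sublocale dust_measure \<subseteq> finite_measure \<Lambda>
  by (rule finite_measure_Lambda)

context dust_measure
begin

lemma nu_density_measurable [measurable]:
  "(\<lambda>x. if x = 0 then \<infinity> else ennreal (1 / x ^ 2)) \<in> borel_measurable \<Lambda>"
  by measurable

lemma AE_unit: "AE x in \<Lambda>. 0 < x \<and> x < 1"
proof -
  have "(\<integral>\<^sup>+ x. (if x = 0 then \<infinity> else ennreal (1 / x ^ 2)) * indicator {0, 1} x \<partial>\<Lambda>) = 0"
    using nu_01 unfolding nu_def by (subst (asm) emeasure_density) (auto simp: sets_Lambda)
  hence "AE x in \<Lambda>. (if x = 0 then \<infinity> else ennreal (1 / x ^ 2)) * indicator {0, 1} x = 0"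
    by (subst (asm) nn_integral_0_iff_AE) auto
  moreover have "AE x in \<Lambda>. x \<notin> UNIV - {0..1}"
    by (rule AE_not_in) (auto simp: null_sets_def Lambda_outside sets_Lambda)
  ultimately show ?thesis
  proof eventually_elim
    case (elim x)
    hence "x \<noteq> 0" "x \<noteq> 1" "0 \<le> x" "x \<le> 1" by (auto split: if_splits)
    thus ?case by simp
  qed
qed

lemma integrable_inverse: "integrable \<Lambda> (\<lambda>x. 1 / x)"
proof (rule integrableI_nonneg)
  show "AE x in \<Lambda>. 0 \<le> 1 / x" using AE_unit by eventually_elim auto
  have "(\<integral>\<^sup>+ x. ennreal (1 / x) \<partial>\<Lambda>) = (\<integral>\<^sup>+ x. (if x = 0 then \<infinity> else ennreal (1 / x ^ 2)) * ennreal x \<partial>\<Lambda>)"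
  proof (rule nn_integral_cong_AE)
    show "AE x in \<Lambda>. ennreal (1 / x) = (if x = 0 then \<infinity> else ennreal (1 / x ^ 2)) * ennreal x"
      using AE_unit by eventually_elim (auto simp: ennreal_mult[symmetric] power2_eq_square)
  qed
  also have "\<dots> = (\<integral>\<^sup>+ x. ennreal x \<partial>nu \<Lambda>)"
    unfolding nu_def by (subst nn_integral_density) auto
  finally show "(\<integral>\<^sup>+ x. ennreal (1 / x) \<partial>\<Lambda>) < \<infinity>" using nu_mean by simp
qed auto

definition mean where "mean = (\<integral>x. 1 / x \<partial>\<Lambda>)"

lemma mean_nonneg: "0 \<le> mean"
  unfolding mean_def using AE_unit by (intro integral_nonneg_AE) (auto elim!: eventually_mono)

lemma bounded_indicator_integrable:
  assumes "0 < e"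
  shows "integrable \<Lambda> (\<lambda>x. indicator {e..u} x * (1 / x ^ 2))"
    "integrable \<Lambda> (\<lambda>x. indicator {e<..} x * (1 / x ^ 2))"
proof -
  have *: "1 / x ^ 2 \<le> 1 / e ^ 2" if "e \<le> x" for x :: real
    using that assms by (intro divide_left_mono power_mono mult_pos_pos zero_less_power) auto
  show "integrable \<Lambda> (\<lambda>x. indicator {e..u} x * (1 / x ^ 2))"
    by (rule integrable_const_bound[where B = "1 / e ^ 2"]) (auto simp: indicator_def *)
  show "integrable \<Lambda> (\<lambda>x. indicator {e<..} x * (1 / x ^ 2))"
    by (rule integrable_const_bound[where B = "1 / e ^ 2"]) (auto simp: indicator_def *)
qed

lemma small_mass_unbounded:
  "\<exists>e>0. e \<le> 1/2 \<and> a \<le> (\<integral>x. indicator {e..1/2} x * (1 / x ^ 2) \<partial>\<Lambda>)"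
proof -
  define F where "F = (\<lambda>k x. ennreal (indicator {1 / (real k + 2)..1/2} x * (1 / x ^ 2)))"
  have "\<infinity> = (\<integral>\<^sup>+ x. (if x = 0 then \<infinity> else ennreal (1 / x ^ 2)) * indicator {0..1} x \<partial>\<Lambda>)"
    using nu_infinite unfolding nu_def by (subst (asm) emeasure_density) (auto simp: sets_Lambda)
  also have "\<dots> = (\<integral>\<^sup>+ x. ennreal (indicator {0<..1/2} x * (1 / x ^ 2)) +
      ennreal (indicator {1/2<..} x * (1 / x ^ 2)) \<partial>\<Lambda>)"
  proof (rule nn_integral_cong_AE)
    show "AE x in \<Lambda>. (if x = 0 then \<infinity> else ennreal (1 / x ^ 2)) * indicator {0..1} x =
      ennreal (indicator {0<..1/2} x * (1 / x ^ 2)) + ennreal (indicator {1/2<..} x * (1 / x ^ 2))"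
      using AE_unit by eventually_elim (auto simp: indicator_def)
  qed
  also have "\<dots> = (\<integral>\<^sup>+ x. ennreal (indicator {0<..1/2} x * (1 / x ^ 2)) \<partial>\<Lambda>) +
      (\<integral>\<^sup>+ x. ennreal (indicator {1/2<..} x * (1 / x ^ 2)) \<partial>\<Lambda>)"
    by (rule nn_integral_add) auto
  finally have "(\<integral>\<^sup>+ x. ennreal (indicator {0<..1/2} x * (1 / x ^ 2)) \<partial>\<Lambda>) +
      (\<integral>\<^sup>+ x. ennreal (indicator {1/2<..} x * (1 / x ^ 2)) \<partial>\<Lambda>) = \<infinity>" by simp
  moreover have "(\<integral>\<^sup>+ x. ennreal (indicator {1/2<..} x * (1 / x ^ 2)) \<partial>\<Lambda>) \<noteq> \<infinity>"
    using bounded_indicator_integrable(2)[of "1/2"] by (simp add: nn_integral_eq_integral)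
  ultimately have inf: "(\<integral>\<^sup>+ x. ennreal (indicator {0<..1/2} x * (1 / x ^ 2)) \<partial>\<Lambda>) = \<infinity>"
    by simp
  have "(SUP k. F k x) = ennreal (indicator {0<..1/2} x * (1 / x ^ 2))" for x
  proof (rule antisym)
    show "(SUP k. F k x) \<le> ennreal (indicator {0<..1/2} x * (1 / x ^ 2))"
    proof (rule SUP_least)
      fix k :: nat
      have "0 < 1 / (real k + 2)" by simp
      hence "x \<in> {0<..1/2}" if "x \<in> {1 / (real k + 2)..1/2}"
        using that by (meson atLeastAtMost_iff greaterThanAtMost_iff less_le_trans)
      thus "F k x \<le> ennreal (indicator {0<..1/2} x * (1 / x ^ 2))"
        unfolding F_def by (intro ennreal_leI mult_right_mono) (auto simp: indicator_def)
    qed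
    show "ennreal (indicator {0<..1/2} x * (1 / x ^ 2)) \<le> (SUP k. F k x)"
    proof (cases "x \<in> {0<..1/2}")
      case True
      obtain k :: nat where "1 / x < real k" using reals_Archimedean2 by blast
      hence "1 / (real k + 2) \<le> x" using True by (auto simp: field_simps)
      hence "ennreal (indicator {0<..1/2} x * (1 / x ^ 2)) = F k x"
        using True by (simp add: F_def)
      thus ?thesis by (metis SUP_upper UNIV_I)
    qed simp
  qed
  moreover have "(\<integral>\<^sup>+ x. (SUP k. F k x) \<partial>\<Lambda>) = (SUP k. \<integral>\<^sup>+ x. F k x \<partial>\<Lambda>)"
  proof (rule nn_integral_monotone_convergence_SUP)
    show "incseq F"
      unfolding F_def incseq_def le_fun_def
    proof (intro allI impI ennreal_leI)
      fix m n :: nat and x :: real assume "m \<le> n"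
      hence "1 / (real n + 2) \<le> 1 / (real m + 2)" by (intro divide_left_mono) auto
      thus "indicator {1 / (real m + 2)..1/2} x * (1 / x ^ 2) \<le> indicator {1 / (real n + 2)..1/2} x * (1 / x ^ 2)"
        by (auto simp: indicator_def)
    qed
    show "\<And>k. F k \<in> borel_measurable \<Lambda>" unfolding F_def by measurable
  qed
  ultimately have "(SUP k. \<integral>\<^sup>+ x. F k x \<partial>\<Lambda>) = \<infinity>" using inf by simp
  then obtain k where k: "ennreal (max a 0) < (\<integral>\<^sup>+ x. F k x \<partial>\<Lambda>)"
    by (metis ennreal_less_top infinity_ennreal_def less_SUP_iff)
  have "(\<integral>\<^sup>+ x. F k x \<partial>\<Lambda>) = ennreal (\<integral>x. indicator {1 / (real k + 2)..1/2} x * (1 / x ^ 2) \<partial>\<Lambda>)"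
    unfolding F_def by (intro nn_integral_eq_integral bounded_indicator_integrable) auto
  with k have "max a 0 < (\<integral>x. indicator {1 / (real k + 2)..1/2} x * (1 / x ^ 2) \<partial>\<Lambda>)"
    using ennreal_less_iff[of "max a 0"] by simp
  hence "a \<le> (\<integral>x. indicator {1 / (real k + 2)..1/2} x * (1 / x ^ 2) \<partial>\<Lambda>)"
    by linarith
  moreover have "1 / (real k + 2) \<le> 1/2" by (intro divide_left_mono) auto
  moreover have "0 < 1 / (real k + 2)" by simp
  ultimately show ?thesis by blast
qed

lemma mass_near_one_small:
  assumes "0 < \<eta>"
  shows "\<exists>\<delta>>0. \<delta> \<le> 1/2 \<and> (\<integral>x. indicator {1 - \<delta><..} x * (1 / x ^ 2) \<partial>\<Lambda>) \<le> \<eta>"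
proof -
  have "(\<lambda>k. \<integral>x. indicator {1 - 1 / (real k + 2)<..} x * (1 / x ^ 2) \<partial>\<Lambda>) \<longlonglongrightarrow> (\<integral>x. 0 \<partial>\<Lambda>)"
  proof (rule integral_dominated_convergence[where w = "\<lambda>_. 4"])
    show "AE x in \<Lambda>. (\<lambda>k. indicator {1 - 1 / (real k + 2)<..} x * (1 / x ^ 2)) \<longlonglongrightarrow> 0"
      using AE_unit
    proof eventually_elim
      case (elim x)
      have "(\<lambda>k. 1 - 1 / (real k + 2)) \<longlonglongrightarrow> 1" by real_asymp
      hence "\<forall>\<^sub>F k in sequentially. x < 1 - 1 / (real k + 2)"
        using elim by (intro order_tendstoD) auto
      hence "\<forall>\<^sub>F k in sequentially. indicator {1 - 1 / (real k + 2)<..} x * (1 / x ^ 2) = 0"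
        by eventually_elim (auto simp: indicator_def)
      thus ?case by (rule tendsto_eventually)
    qed
    fix k :: nat
    show "AE x in \<Lambda>. norm (indicator {1 - 1 / (real k + 2)<..} x * (1 / x ^ 2)) \<le> 4"
    proof (rule AE_I2)
      fix x :: real
      show "norm (indicator {1 - 1 / (real k + 2)<..} x * (1 / x ^ 2)) \<le> 4"
      proof (cases "1 - 1 / (real k + 2) < x")
        case True
        have "1 / (real k + 2) \<le> 1 / 2" by (intro divide_left_mono) auto
        hence "1 / 2 \<le> x" using True by linarith
        hence "(1 / 2) ^ 2 \<le> x ^ 2" by (intro power_mono) auto
        hence "1 / x ^ 2 \<le> 1 / (1 / 2) ^ 2" using \<open>1 / 2 \<le> x\<close> by (intro divide_left_mono mult_pos_pos zero_less_power) auto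
        thus ?thesis using True by (simp add: power2_eq_square)
      qed simp
    qed
  qed auto
  hence "\<forall>\<^sub>F k in sequentially. (\<integral>x. indicator {1 - 1 / (real k + 2)<..} x * (1 / x ^ 2) \<partial>\<Lambda>) < \<eta>"
    using assms by (intro order_tendstoD(2)) auto
  then obtain k :: nat where "(\<integral>x. indicator {1 - 1 / (real k + 2)<..} x * (1 / x ^ 2) \<partial>\<Lambda>) < \<eta>"
    by (auto simp: eventually_sequentially)
  moreover have "1 / (real k + 2) \<le> 1 / 2" by (intro divide_left_mono) auto
  ultimately show ?thesis by (intro exI[of _ "1 / (real k + 2)"]) auto
qed

lemma Gen_le:
  assumes "p \<in> parts n" "integrable \<Lambda> g"
    and le: "\<And>x. 0 < x \<Longrightarrow> x < 1 \<Longrightarrow>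
      (\<Sum>B\<in>{B \<in> Pow p. 2 \<le> card B}. bw x p B * (f (merge p B) - f p)) \<le> x ^ 2 * g x"
  shows "Gen \<Lambda> f p \<le> (\<integral>x. g x \<partial>\<Lambda>)"
proof -
  let ?S = "{B \<in> Pow p. 2 \<le> card B}"
  let ?w = "\<lambda>x B. x ^ (card B - 2) * (1 - x) ^ (card p - card B) * (f (merge p B) - f p)"
  have int: "integrable \<Lambda> (\<lambda>x. x ^ k * (1 - x) ^ j)" for k j :: nat
  proof (rule integrable_const_bound[where B = 1])
    show "AE x in \<Lambda>. norm (x ^ k * (1 - x) ^ j) \<le> 1"
      using AE_unit by eventually_elim (auto simp: abs_mult power_le_one mult_le_one)
  qed auto
  have "Gen \<Lambda> f p = (\<integral>x. (\<Sum>B\<in>?S. ?w x B) \<partial>\<Lambda>)"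
    unfolding Gen_def lam_def by (subst Bochner_Integration.integral_sum) (auto intro!: int)
  also have "\<dots> \<le> (\<integral>x. g x \<partial>\<Lambda>)"
  proof (rule integral_mono_AE)
    show "AE x in \<Lambda>. (\<Sum>B\<in>?S. ?w x B) \<le> g x"
      using AE_unit
    proof eventually_elim
      case (elim x)
      have "x ^ 2 * (\<Sum>B\<in>?S. ?w x B) = (\<Sum>B\<in>?S. bw x p B * (f (merge p B) - f p))"
        unfolding sum_distrib_left
      proof (intro sum.cong refl)
        fix B assume "B \<in> ?S"
        hence "2 \<le> card B" by simp
        hence B: "2 + (card B - 2) = card B" by arith
        have "x ^ 2 * x ^ (card B - 2) = x ^ card B"
          unfolding power_add[symmetric] B ..
        thus "x ^ 2 * ?w x B = bw x p B * (f (merge p B) - f p)"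
          by (simp add: bw_def mult.assoc[symmetric])
      qed
      also have "\<dots> \<le> x ^ 2 * g x" using elim by (intro le) auto
      finally show ?case using elim by simp
    qed
  qed (use assms in \<open>auto intro!: int\<close>)
  finally show ?thesis .
qed

lemma Gen_log_singletons_le:
  assumes p: "p \<in> parts n" and d: "0 < \<delta>" "\<delta> \<le> 1/2"
  shows "Gen \<Lambda> (\<lambda>p. ln (1 + real n) - ln (1 + real (card (sing p)))) p
    \<le> mean / \<delta> + ln (1 + real n) * (\<integral>x. indicator {1 - \<delta><..} x * (1 / x ^ 2) \<partial>\<Lambda>)"
proof -
  let ?g = "\<lambda>x. (1 / \<delta>) * (1 / x) + ln (1 + real n) * (indicator {1 - \<delta><..} x * (1 / x ^ 2))"
  have ig: "integrable \<Lambda> (\<lambda>x. indicator {1 - \<delta><..} x * (1 / x ^ 2))"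
    using d by (intro bounded_indicator_integrable) auto
  note fin = finite_part(1)[OF p] finite_sing_nons[OF p]
  define S where "S = sing p"
  define s where "s = card S"
  define D where "D = (\<lambda>C :: nat set set. ln (1 + real s) - ln (1 + real (s - card C)))"
  have D0: "0 \<le> D C" for C unfolding D_def by simp
  have Dn: "D C \<le> ln (1 + real n)" for C
  proof -
    have "ln (1 + real s) \<le> ln (1 + real n)"
      using card_sing_le[OF p] unfolding s_def S_def by simp
    thus ?thesis unfolding D_def by (smt (verit) ln_ge_zero of_nat_0_le_iff)
  qed
  have D1: "D C \<le> (1 + real s) * (1 / (1 + real (s - card C))) - 1" for C
  proof -
    have "D C = ln ((1 + real s) / (1 + real (s - card C)))"
      unfolding D_def by (subst ln_div) auto
    also have "\<dots> \<le> (1 + real s) / (1 + real (s - card C)) - 1" by (rule ln_le_minus_one) simp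
    finally show ?thesis by simp
  qed
  have "Gen \<Lambda> (\<lambda>p. ln (1 + real n) - ln (1 + real (card (sing p)))) p \<le> (\<integral>x. ?g x \<partial>\<Lambda>)"
  proof (rule Gen_le[OF p])
    show "integrable \<Lambda> ?g"
      by (intro Bochner_Integration.integrable_add integrable_mult_right integrable_inverse ig)
    fix x :: real assume x: "0 < x" "x < 1"
    let ?d = "\<lambda>B. ln (1 + real n) - ln (1 + real (card (sing (merge p B)))) - (ln (1 + real n) - ln (1 + real (card (sing p))))"
    have "(\<Sum>B\<in>{B \<in> Pow p. 2 \<le> card B}. bw x p B * ?d B)
       = (\<Sum>B\<in>{B \<in> Pow p. 2 \<le> card B}. bw x p B * D (B \<inter> S))"
      by (intro sum.cong refl) (auto simp: D_def s_def S_def card_sing_merge[OF p])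
    also have "\<dots> \<le> (\<Sum>B\<in>Pow p. bw x p B * D (B \<inter> S))"
      using fin x by (intro sum_mono2 mult_nonneg_nonneg bw_nonneg D0) auto
    also have "\<dots> = (\<Sum>C\<in>Pow S. bw x S C * D C)"
      using sum_Pow_bw_marginal[of S "nons p" x D] fin sing_nons[of p] unfolding S_def by simp
    finally have le: "(\<Sum>B\<in>{B \<in> Pow p. 2 \<le> card B}. bw x p B * ?d B) \<le> (\<Sum>C\<in>Pow S. bw x S C * D C)" .
    have finS: "finite S" using fin by (simp add: S_def)
    show "(\<Sum>B\<in>{B \<in> Pow p. 2 \<le> card B}. bw x p B * ?d B) \<le> x ^ 2 * ?g x"
    proof (cases "x \<le> 1 - \<delta>")
      case True
      have "(\<Sum>C\<in>Pow S. bw x S C * D C) \<le>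
         (\<Sum>C\<in>Pow S. bw x S C * ((1 + real s) * (1 / (1 + real (s - card C))) - 1))"
        using x by (intro sum_mono mult_left_mono D1 bw_nonneg) auto
      also have "\<dots> = (1 + real s) * (\<Sum>C\<in>Pow S. bw x S C * (1 / (1 + real (s - card C)))) - (\<Sum>C\<in>Pow S. bw x S C)"
        unfolding sum_distrib_left sum_subtractf[symmetric] by (intro sum.cong refl) (simp add: algebra_simps)
      also have "\<dots> \<le> (1 + real s) * (1 / ((1 + real s) * (1 - x))) - 1"
        using sum_Pow_bw_recip[OF finS, of x] x sum_Pow_bw[OF finS, of x]
        unfolding s_def by (intro diff_mono mult_left_mono) auto
      also have "\<dots> = 1 / (1 - x) - 1"
      proof -
        have "1 + real s \<noteq> 0" by linarith
        thus ?thesis by simp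
      qed
      also have "\<dots> = x * (1 / (1 - x))" using x by (simp add: field_simps)
      also have "\<dots> \<le> x * (1 / \<delta>)"
        using x d True by (intro mult_left_mono divide_left_mono) auto
      also have "\<dots> = x ^ 2 * ?g x" using True x by (simp add: power2_eq_square)
      finally show ?thesis using le by simp
    next
      case False
      have "(\<Sum>C\<in>Pow S. bw x S C * D C) \<le> (\<Sum>C\<in>Pow S. bw x S C * ln (1 + real n))"
        using x by (intro sum_mono mult_left_mono Dn bw_nonneg) auto
      also have "\<dots> = ln (1 + real n)"
        by (simp add: sum_distrib_right[symmetric] sum_Pow_bw[OF finS])
      also have "\<dots> \<le> x ^ 2 * ((1 / \<delta>) * (1 / x)) + ln (1 + real n)"
        using d x by simp
      also have "\<dots> = x ^ 2 * ?g x" using False x by (simp add: field_simps power2_eq_square)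
      finally show ?thesis using le by simp
    qed
  qed
  also have "\<dots> = mean / \<delta> + ln (1 + real n) * (\<integral>x. indicator {1 - \<delta><..} x * (1 / x ^ 2) \<partial>\<Lambda>)"
  proof -
    have "(\<integral>x. ?g x \<partial>\<Lambda>) = (\<integral>x. (1 / \<delta>) * (1 / x) \<partial>\<Lambda>)
        + (\<integral>x. ln (1 + real n) * (indicator {1 - \<delta><..} x * (1 / x ^ 2)) \<partial>\<Lambda>)"
      by (intro Bochner_Integration.integral_add integrable_mult_right integrable_inverse ig)
    thus ?thesis unfolding integral_mult_right_zero mean_def by simp
  qed
  finally show ?thesis .
qed

lemma merge_deficit_le:
  assumes "p \<in> parts n" "B \<subseteq> p" "2 \<le> card B"
  shows "real (K - card (nons (merge p B))) - real (K - card (nons p)) \<le>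
    real K / real (card (nons p)) * real (card (B \<inter> nons p))
    - of_bool (B \<inter> nons p = {} \<and> card (nons p) < K)"
proof -
  define d where "d = card (nons p)"
  define L where "L = card (B \<inter> nons p)"
  have fin: "finite (nons p)" using finite_sing_nons[OF assms(1)] by simp
  have L0: "L = 0 \<longleftrightarrow> B \<inter> nons p = {}" unfolding L_def using fin by simp
  have Ld: "L \<le> d" unfolding L_def d_def using fin by (intro card_mono) auto
  have m: "card (nons (merge p B)) = Suc (d - L)"
    using card_nons_merge[OF assms] by (simp add: d_def L_def)
  have "real (K - Suc (d - L)) - real (K - d) \<le> real K / real d * real L - of_bool (L = 0 \<and> d < K)"
  proof (cases "L = 0")
    case True
    thus ?thesis by (cases "d < K") auto
  next
    case False
    hence d: "0 < d" using Ld by simp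
    have "real (K - Suc (d - L)) - real (K - d) \<le> real K / real d * real L"
    proof (cases "d \<le> K")
      case True
      have "real (K - Suc (d - L)) - real (K - d) \<le> real L"
        using True Ld False by (simp add: of_nat_diff)
      also have "\<dots> \<le> real K / real d * real L"
        using True d mult_right_mono[of 1 "real K / real d" "real L"] by simp
      finally show ?thesis .
    next
      case gt: False
      show ?thesis
      proof (cases "d - L < K")
        case True
        define u where "u = d - L"
        have L: "real L = real d - real u" using Ld by (simp add: u_def of_nat_diff)
        have "real K * real u \<le> real d * (1 + real u)"
          using gt by (intro mult_mono) auto
        hence "(real K - 1 - real u) * real d \<le> real K * (real d - real u)"
          by (simp add: algebra_simps)
        hence "real K - 1 - real u \<le> real K / real d * real L"
          using d unfolding L by (simp add: field_simps)
        thus ?thesis using True gt unfolding u_def by (simp add: of_nat_diff)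
      next
        case False
        thus ?thesis using gt by simp
      qed
    qed
    thus ?thesis using False by simp
  qed
  thus ?thesis unfolding m L0 unfolding d_def L_def .
qed

lemma Gen_deficit_le:
  assumes p: "p \<in> parts n" and e: "0 < e" "e \<le> 1/2"
    and m: "\<And>s. m \<le> s \<Longrightarrow> (1 + real s) * (1 - e) ^ (s - 1) \<le> 1/2"
  shows "Gen \<Lambda> (\<lambda>p. real (K - card (nons p))) p \<le> K * mean
    - of_bool (card (nons p) < K \<and> m \<le> card (sing p)) * ((1/2) ^ Suc K *
        (\<integral>x. indicator {e..1/2} x * (1 / x ^ 2) \<partial>\<Lambda>))"
proof -
  define S where "S = sing p"
  define N where "N = nons p"
  define I :: real where "I = of_bool (card N < K \<and> m \<le> card S)"
  let ?i = "\<lambda>x. indicator {e..1/2} x * (1 / x ^ 2) :: real"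
  let ?g = "\<lambda>x. K * (1 / x) - I * ((1/2) ^ Suc K * ?i x)"
  have ig: "integrable \<Lambda> ?i"
    using e by (intro bounded_indicator_integrable) auto
  have fin: "finite p" "finite S" "finite N"
    using finite_part(1)[OF p] finite_sing_nons[OF p] by (auto simp: S_def N_def)
  have un: "p = S \<union> N" "S \<inter> N = {}" "N \<inter> S = {}" using sing_nons[of p] by (auto simp: S_def N_def)
  have cp: "card p = card S + card N" using un fin by (metis card_Un_disjoint)
  have "Gen \<Lambda> (\<lambda>p. real (K - card (nons p))) p \<le> (\<integral>x. ?g x \<partial>\<Lambda>)"
  proof (rule Gen_le[OF p])
    show "integrable \<Lambda> ?g"
      by (intro Bochner_Integration.integrable_diff integrable_mult_right integrable_inverse ig)
    fix x :: real assume x: "0 < x" "x < 1"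
    have "(\<Sum>B\<in>{B \<in> Pow p. 2 \<le> card B}. bw x p B * (real (K - card (nons (merge p B))) - real (K - card (nons p))))
       \<le> (\<Sum>B\<in>{B \<in> Pow p. 2 \<le> card B}. bw x p B * (K / card N * card (B \<inter> N) - of_bool (B \<inter> N = {} \<and> card N < K)))"
    proof (rule sum_mono)
      fix B assume B: "B \<in> {B \<in> Pow p. 2 \<le> card B}"
      hence "real (K - card (nons (merge p B))) - real (K - card (nons p))
          \<le> real K / real (card N) * real (card (B \<inter> N)) - of_bool (B \<inter> N = {} \<and> card N < K)"
        unfolding N_def by (intro merge_deficit_le[OF p]) auto
      thus "bw x p B * (real (K - card (nons (merge p B))) - real (K - card (nons p))) \<le>
          bw x p B * (K / card N * card (B \<inter> N) - of_bool (B \<inter> N = {} \<and> card N < K))"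
        using x by (intro mult_left_mono bw_nonneg) auto
    qed
    also have "\<dots> = (\<Sum>B\<in>{B \<in> Pow p. 2 \<le> card B}. bw x p B * (K / card N * card (B \<inter> N)))
        - (\<Sum>B\<in>{B \<in> Pow p. 2 \<le> card B}. bw x p B * of_bool (B \<inter> N = {} \<and> card N < K))"
      by (simp add: right_diff_distrib sum_subtractf)
    also have "\<dots> \<le> K * x - I * ((1/2) ^ Suc K * indicator {e..1/2} x)"
    proof (rule diff_mono)
      have "(\<Sum>B\<in>{B \<in> Pow p. 2 \<le> card B}. bw x p B * (K / card N * card (B \<inter> N)))
         \<le> (\<Sum>B\<in>Pow p. bw x p B * (K / card N * card (B \<inter> N)))"
        using fin x by (intro sum_mono2 mult_nonneg_nonneg bw_nonneg) auto
      also have "\<dots> = K / card N * (\<Sum>B\<in>Pow (S \<union> N). bw x (S \<union> N) B * card (B \<inter> N))"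
        unfolding un(1)[symmetric] by (simp add: sum_distrib_left mult_ac)
      also have "\<dots> = K / card N * (\<Sum>B\<in>Pow N. bw x N B * card B)"
        using sum_Pow_bw_marginal[of N S x "\<lambda>B. real (card B)"] fin un by simp
      also have "\<dots> = K / card N * (x * card N)" using fin by (simp add: sum_Pow_bw_card)
      also have "\<dots> \<le> K * x" using x by (cases "card N = 0") auto
      finally show "(\<Sum>B\<in>{B \<in> Pow p. 2 \<le> card B}. bw x p B * (K / card N * card (B \<inter> N))) \<le> K * x" .
      show "I * ((1/2) ^ Suc K * indicator {e..1/2} x) \<le>
        (\<Sum>B\<in>{B \<in> Pow p. 2 \<le> card B}. bw x p B * of_bool (B \<inter> N = {} \<and> card N < K))"
      proof (cases "card N < K \<and> m \<le> card S \<and> x \<in> {e..1/2}")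
        case True
        let ?s = "card S"
        have "(1 - x) ^ ?s + ?s * x * (1 - x) ^ (?s - 1) \<le> (1 - x) ^ (?s - 1) + ?s * (1 - x) ^ (?s - 1)"
        proof (rule add_mono)
          show "(1 - x) ^ ?s \<le> (1 - x) ^ (?s - 1)" using x by (intro power_decreasing) auto
          have "real ?s * x \<le> real ?s" using x by (simp add: mult_left_le)
          thus "?s * x * (1 - x) ^ (?s - 1) \<le> ?s * (1 - x) ^ (?s - 1)"
            using x by (intro mult_right_mono) auto
        qed
        also have "\<dots> = (1 + real ?s) * (1 - x) ^ (?s - 1)" by (simp add: algebra_simps)
        also have "\<dots> \<le> (1 + real ?s) * (1 - e) ^ (?s - 1)"
          using True x by (intro mult_left_mono power_mono) auto
        also have "\<dots> \<le> 1/2" using True m by simp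
        finally have half: "1/2 \<le> (\<Sum>B\<in>{B \<in> Pow S. 2 \<le> card B}. bw x S B)"
          using sum_Pow_bw_ge2[OF fin(2), of x] by linarith
        have "(1/2 :: real) ^ K \<le> (1/2) ^ card N" using True by (intro power_decreasing) auto
        also have "\<dots> \<le> (1 - x) ^ card N" using True by (intro power_mono) auto
        finally have "(1/2) ^ K * (1/2) \<le> (1 - x) ^ card N * (\<Sum>B\<in>{B \<in> Pow S. 2 \<le> card B}. bw x S B)"
          using half x by (intro mult_mono) auto
        also have "\<dots> = (\<Sum>B\<in>{B \<in> Pow S. 2 \<le> card B}. bw x p B)"
          unfolding sum_distrib_left
        proof (intro sum.cong refl)
          fix B assume "B \<in> {B \<in> Pow S. 2 \<le> card B}"
          hence "card B \<le> card S" using fin by (auto intro: card_mono)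
          hence "card p - card B = card N + (card S - card B)" using cp by simp
          thus "(1 - x) ^ card N * bw x S B = bw x p B"
            by (simp add: bw_def power_add)
        qed
        also have "\<dots> = (\<Sum>B\<in>{B \<in> Pow p. 2 \<le> card B}. bw x p B * of_bool (B \<inter> N = {} \<and> card N < K))"
          using fin un True by (intro sum.mono_neutral_cong_left) auto
        finally show ?thesis using True by (simp add: I_def mult_ac)
      next
        case False
        have "0 \<le> (\<Sum>B\<in>{B \<in> Pow p. 2 \<le> card B}. bw x p B * of_bool (B \<inter> N = {} \<and> card N < K))"
          using x by (intro sum_nonneg mult_nonneg_nonneg bw_nonneg) auto
        thus ?thesis using False by (auto simp: I_def)
      qed
    qed
    also have "\<dots> = x ^ 2 * ?g x" using x by (simp add: power2_eq_square field_simps)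
    finally show "(\<Sum>B\<in>{B \<in> Pow p. 2 \<le> card B}. bw x p B * (real (K - card (nons (merge p B))) - real (K - card (nons p)))) \<le> x ^ 2 * ?g x" .
  qed
  also have "\<dots> = K * mean - I * ((1/2) ^ Suc K * (\<integral>x. ?i x \<partial>\<Lambda>))"
    unfolding mean_def
    by (subst Bochner_Integration.integral_diff)
      (simp_all add: integrable_inverse ig integrable_mult_right del: times_divide_eq_right power_Suc)
  finally show ?thesis by (simp add: I_def N_def S_def)
qed

end

lemma gronwall_linear:
  fixes y y' :: "real \<Rightarrow> real"
  assumes "0 < a" "0 \<le> t"
    and y: "\<And>u. 0 \<le> u \<Longrightarrow> u \<le> t \<Longrightarrow> (y has_real_derivative y' u) (at u)"
    and le: "\<And>u. 0 \<le> u \<Longrightarrow> u \<le> t \<Longrightarrow> y' u \<le> b - a * y u"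
  shows "y t \<le> (y 0 - b / a) * exp (- a * t) + b / a"
proof -
  define z where "z = (\<lambda>u. exp (a * u) * (y u - b / a))"
  have "z t \<le> z 0"
  proof (rule DERIV_nonpos_imp_nonincreasing[OF assms(2)])
    fix u assume u: "0 \<le> u" "u \<le> t"
    have "(z has_real_derivative (exp (a * u) * a * (y u - b / a) + y' u * exp (a * u))) (at u)"
      unfolding z_def using y[OF u] by (auto intro!: derivative_eq_intros)
    moreover have "exp (a * u) * a * (y u - b / a) + y' u * exp (a * u) = exp (a * u) * (y' u - (b - a * y u))"
      using assms(1) by (simp add: field_simps)
    moreover have "\<dots> \<le> 0" using le[OF u] by (simp add: mult_nonneg_nonpos)
    ultimately show "\<exists>d. (z has_real_derivative d) (at u) \<and> d \<le> 0" by metis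
  qed
  hence "exp (a * t) * (y t - b / a) \<le> y 0 - b / a" by (simp add: z_def)
  hence "exp (- a * t) * (exp (a * t) * (y t - b / a)) \<le> exp (- a * t) * (y 0 - b / a)"
    by (intro mult_left_mono) auto
  also have "exp (- a * t) * (exp (a * t) * (y t - b / a)) = y t - b / a"
    by (simp add: mult.assoc[symmetric] exp_add[symmetric])
  finally show ?thesis by (simp add: mult.commute)
qed

locale dust_coalescent = dust_measure \<Lambda> + M: prob_space M
  for \<Lambda> :: "real measure" and M :: "'a measure" +
  fixes Pt :: "real \<Rightarrow> 'a \<Rightarrow> nat set set"
  assumes coalescent: "is_Lambda_coalescent \<Lambda> M Pt"
begin

lemma partition_Pt: "0 \<le> u \<Longrightarrow> \<omega> \<in> space M \<Longrightarrow> partition_on {1..} (Pt u \<omega>)"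
  using coalescent by (simp add: is_Lambda_coalescent_def)

lemma measurable_iota: "1 \<le> n \<Longrightarrow> 0 \<le> u \<Longrightarrow> (\<lambda>\<omega>. iota n (Pt u \<omega>)) \<in> measurable M (count_space UNIV)"
  using coalescent by (simp add: is_Lambda_coalescent_def)

lemma sets_iota:
  assumes "1 \<le> n" "0 \<le> u"
  shows "{\<omega> \<in> space M. P (iota n (Pt u \<omega>))} \<in> sets M"
proof -
  have "(\<lambda>\<omega>. iota n (Pt u \<omega>)) -` Collect P \<inter> space M \<in> sets M"
    by (rule measurable_sets[OF measurable_iota[OF assms]]) simp
  thus ?thesis by (simp add: vimage_def Int_def conj_commute)
qed

lemma prob_iota_eq:
  assumes "1 \<le> n" "0 \<le> u"
  shows "M.prob {\<omega> \<in> space M. iota n (Pt u \<omega>) = q} = Ptrans \<Lambda> n u (singletons n) q"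
proof -
  have "\<forall>n\<ge>1. \<forall>ts ps. sorted ts \<longrightarrow> (\<forall>t\<in>set ts. t \<ge> 0) \<longrightarrow> length ps = length ts \<longrightarrow>
        measure M {\<omega>\<in>space M. \<forall>j<length ts. iota n (Pt (ts ! j) \<omega>) = ps ! j}
        = (\<Prod>j<length ts. Ptrans \<Lambda> n (ts ! j - (0 # ts) ! j) ((singletons n # ps) ! j) (ps ! j))"
    using coalescent by (simp add: is_Lambda_coalescent_def)
  from this[rule_format, OF assms(1), of "[u]" "[q]"] show ?thesis using assms(2) by simp
qed

definition E :: "nat \<Rightarrow> real \<Rightarrow> (nat set set \<Rightarrow> real) \<Rightarrow> real" where
  "E n u f = (\<Sum>q\<in>parts n. Ptrans \<Lambda> n u (singletons n) q * f q)"

lemma E_of_bool: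
  assumes "1 \<le> n" "0 \<le> u"
  shows "E n u (\<lambda>q. of_bool (P q)) = M.prob {\<omega> \<in> space M. P (iota n (Pt u \<omega>))}"
proof -
  let ?I = "{q \<in> parts n. P q}"
  have "{\<omega> \<in> space M. P (iota n (Pt u \<omega>))} = (\<Union>q\<in>?I. {\<omega> \<in> space M. iota n (Pt u \<omega>) = q})"
    using iota_in_parts[OF partition_Pt[OF assms(2)]] by auto
  also have "M.prob \<dots> = (\<Sum>q\<in>?I. M.prob {\<omega> \<in> space M. iota n (Pt u \<omega>) = q})"
    using finite_parts sets_iota[OF assms]
    by (intro M.finite_measure_finite_Union) (auto simp: disjoint_family_on_def)
  also have "\<dots> = (\<Sum>q\<in>?I. Ptrans \<Lambda> n u (singletons n) q)"
    by (simp add: prob_iota_eq[OF assms])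
  also have "\<dots> = E n u (\<lambda>q. of_bool (P q))"
    unfolding E_def by (intro sum.mono_neutral_cong_left finite_parts) auto
  finally show ?thesis ..
qed

lemma Ptrans_nonneg: "1 \<le> n \<Longrightarrow> 0 \<le> u \<Longrightarrow> 0 \<le> Ptrans \<Lambda> n u (singletons n) q"
  by (metis prob_iota_eq measure_nonneg)

lemma E_const: "1 \<le> n \<Longrightarrow> 0 \<le> u \<Longrightarrow> E n u (\<lambda>_. c) = c"
  using E_of_bool[of n u "\<lambda>_. True"] by (simp add: E_def M.prob_space sum_distrib_right[symmetric])

lemma E_mono:
  assumes "1 \<le> n" "0 \<le> u" "\<And>q. q \<in> parts n \<Longrightarrow> f q \<le> g q"
  shows "E n u f \<le> E n u g"
  unfolding E_def using assms by (intro sum_mono mult_left_mono Ptrans_nonneg)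

lemma E_diff: "E n u (\<lambda>q. f q - g q) = E n u f - E n u g"
  by (simp add: E_def algebra_simps sum_subtractf)

lemma E_cmult: "E n u (\<lambda>q. c * f q) = c * E n u f"
  by (simp add: E_def sum_distrib_left mult_ac)

lemma E_0: "E n 0 f = f (singletons n)"
proof -
  have "E n 0 f = (\<Sum>q\<in>parts n. if singletons n = q then f q else 0)"
    unfolding E_def Ptrans_0 by (intro sum.cong) auto
  thus ?thesis by (simp add: finite_parts singletons_in_parts)
qed

lemma E_has_derivative: "((\<lambda>u. E n u f) has_real_derivative E n u (Gen \<Lambda> f)) (at u)"
  unfolding E_def by (rule sum_Ptrans_has_derivative)

lemma few_singletons_unlikely:
  assumes "0 < \<epsilon>" "0 \<le> T"
  shows "\<forall>\<^sub>F n in sequentially. \<forall>u\<in>{0..T}. E n u (\<lambda>q. of_bool (card (sing q) < m)) \<le> \<epsilon>"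
proof -
  obtain \<delta> where \<delta>: "0 < \<delta>" "\<delta> \<le> 1/2"
    "(\<integral>x. indicator {1 - \<delta><..} x * (1 / x ^ 2) \<partial>\<Lambda>) \<le> \<epsilon> / (4 * (T + 1))"
    using mass_near_one_small[of "\<epsilon> / (4 * (T + 1))"] assms by auto
  define \<eta> where "\<eta> = (\<integral>x. indicator {1 - \<delta><..} x * (1 / x ^ 2) \<partial>\<Lambda>)"
  have "\<forall>\<^sub>F n in sequentially. 2 * ln (1 + real m) \<le> ln (1 + real n)"
    by real_asymp
  moreover have "\<forall>\<^sub>F n in sequentially. 4 * T * (mean / \<delta>) / \<epsilon> \<le> ln (1 + real n)"
    by real_asymp
  moreover have "\<forall>\<^sub>F n :: nat in sequentially. 1 \<le> n"
    by (rule eventually_ge_at_top)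
  ultimately show ?thesis
  proof eventually_elim
    case (elim n)
    define L where "L = ln (1 + real n)"
    have L: "0 < L" using elim(3) by (simp add: L_def)
    let ?f = "\<lambda>p. ln (1 + real n) - ln (1 + real (card (sing p)))"
    define C where "C = mean / \<delta> + L * \<eta>"
    show ?case
    proof
      fix u assume "u \<in> {0..T}"
      hence u: "0 \<le> u" "u \<le> T" by auto
      have "E n u ?f - C * u \<le> E n 0 ?f - C * 0"
      proof (rule DERIV_nonpos_imp_nonincreasing[OF u(1)])
        fix v :: real assume v: "0 \<le> v"
        have "((\<lambda>u. E n u ?f - C * u) has_real_derivative (E n v (Gen \<Lambda> ?f) - C)) (at v)"
          by (auto intro!: derivative_eq_intros E_has_derivative)
        moreover have "E n v (Gen \<Lambda> ?f) \<le> E n v (\<lambda>_. C)"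
          unfolding C_def L_def \<eta>_def using \<delta> elim(3) v
          by (intro E_mono Gen_log_singletons_le)
        hence "E n v (Gen \<Lambda> ?f) - C \<le> 0" using E_const[OF elim(3) v] by simp
        ultimately show "\<exists>d. ((\<lambda>u. E n u ?f - C * u) has_real_derivative d) (at v) \<and> d \<le> 0" by blast
      qed
      hence "E n u ?f \<le> C * u" by (simp add: E_0 card_sing_singletons)
      also have "\<dots> \<le> C * T"
      proof -
        have "0 \<le> \<eta>" unfolding \<eta>_def by (intro integral_nonneg_AE) auto
        thus ?thesis using u L \<delta> mean_nonneg unfolding C_def by (intro mult_left_mono) auto
      qed
      finally have 1: "E n u ?f \<le> C * T" .
      have "E n u (\<lambda>q. L / 2 * of_bool (card (sing q) < m)) \<le> E n u ?f"
      proof (rule E_mono[OF elim(3) u(1)])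
        fix q assume q: "q \<in> parts n"
        show "L / 2 * of_bool (card (sing q) < m) \<le> ?f q"
        proof (cases "card (sing q) < m")
          case True
          hence "ln (1 + real (card (sing q))) \<le> ln (1 + real m)" by simp
          hence "L / 2 \<le> ?f q" using elim(1) unfolding L_def by linarith
          thus ?thesis using True by simp
        next
          case False
          thus ?thesis using card_sing_le[OF q] by simp
        qed
      qed
      hence "L / 2 * E n u (\<lambda>q. of_bool (card (sing q) < m)) \<le> C * T"
        using 1 unfolding E_cmult by simp
      hence "E n u (\<lambda>q. of_bool (card (sing q) < m)) \<le> 2 * C * T / L"
        using L by (simp add: field_simps)
      also have "\<dots> = 2 * T * (mean / \<delta>) / L + 2 * T * \<eta>"
        using L unfolding C_def by (simp add: field_simps)
      also have "2 * T * (mean / \<delta>) / L \<le> \<epsilon> / 2"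
      proof -
        have "4 * T * (mean / \<delta>) \<le> L * \<epsilon>"
          using elim(2) assms(1) by (simp only: L_def[symmetric] pos_divide_le_eq)
        hence "2 * T * (mean / \<delta>) \<le> L * \<epsilon> / 2" by linarith
        also have "\<dots> = (\<epsilon> / 2) * L" by simp
        finally show ?thesis using L by (simp only: pos_divide_le_eq)
      qed
      also have "2 * T * \<eta> \<le> 2 * T * (\<epsilon> / (4 * (T + 1)))"
        using \<delta> assms unfolding \<eta>_def by (intro mult_left_mono) auto
      also have "\<dots> \<le> \<epsilon> / 2"
        using assms by (simp add: field_simps)
      finally show "E n u (\<lambda>q. of_bool (card (sing q) < m)) \<le> \<epsilon>" by simp
    qed
  qed
qed

lemma few_nonsingletons_unlikely:
  assumes "0 < \<epsilon>" "0 < t"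
  shows "\<exists>n\<ge>1. M.prob {\<omega> \<in> space M. card (nons (iota n (Pt t \<omega>))) < K} \<le> \<epsilon>"
proof (cases "K = 0")
  case True
  thus ?thesis using assms by (intro exI[of _ 1]) simp
next
  case False
  hence K: "0 < real K" by simp
  define a0 where "a0 = 2 * (real K ^ 2 * (1 / t + mean)) / \<epsilon> + 1"
  have a0: "1 \<le> a0" unfolding a0_def using assms mean_nonneg K by simp
  obtain e where e: "0 < e" "e \<le> 1/2"
    "2 ^ Suc K * a0 \<le> (\<integral>x. indicator {e..1/2} x * (1 / x ^ 2) \<partial>\<Lambda>)"
    using small_mass_unbounded[of "2 ^ Suc K * a0"] by blast
  define A where "A = (1/2) ^ Suc K * (\<integral>x. indicator {e..1/2} x * (1 / x ^ 2) \<partial>\<Lambda>)"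
  have "(1/2) ^ Suc K * (2 ^ Suc K * a0) \<le> A"
    unfolding A_def by (intro mult_left_mono e) simp
  hence A0: "a0 \<le> A" by (simp add: power_one_over)
  hence A: "0 < A" using a0 by simp
  have "(\<lambda>j. of_nat j * (1 - e) ^ j + 2 * (1 - e) ^ j) \<longlonglongrightarrow> 0 + 2 * 0"
    using e by (intro tendsto_intros powser_times_n_limit_0 LIMSEQ_power_zero) auto
  hence "\<forall>\<^sub>F j in sequentially. of_nat j * (1 - e) ^ j + 2 * (1 - e) ^ j < 1/2"
    by (rule order_tendstoD) simp
  then obtain J where J: "\<And>j. J \<le> j \<Longrightarrow> of_nat j * (1 - e) ^ j + 2 * (1 - e) ^ j < 1/2"
    by (auto simp: eventually_sequentially)
  define m where "m = Suc J"
  have m: "(1 + real s) * (1 - e) ^ (s - 1) \<le> 1/2" if "m \<le> s" for s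
  proof -
    obtain j where s: "s = Suc j" "J \<le> j" using \<open>m \<le> s\<close> unfolding m_def by (cases s) auto
    thus ?thesis using J[of j] by (simp add: algebra_simps)
  qed
  define \<epsilon>' where "\<epsilon>' = \<epsilon> / (2 * K)"
  have "\<forall>\<^sub>F n in sequentially. 1 \<le> n \<and> (\<forall>u\<in>{0..t}. E n u (\<lambda>q. of_bool (card (sing q) < m)) \<le> \<epsilon>')"
    using few_singletons_unlikely[of \<epsilon>' t m] eventually_ge_at_top[of 1] assms K
    by (auto simp: \<epsilon>'_def intro: eventually_conj)
  then obtain n where n: "1 \<le> n" "\<And>u. 0 \<le> u \<Longrightarrow> u \<le> t \<Longrightarrow> E n u (\<lambda>q. of_bool (card (sing q) < m)) \<le> \<epsilon>'"
    by (auto simp: eventually_sequentially)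
  let ?h = "\<lambda>p. real (K - card (nons p))"
  define b where "b = K * mean + A * \<epsilon>'"
  have "E n t ?h \<le> (E n 0 ?h - b / (A / K)) * exp (- (A / K) * t) + b / (A / K)"
  proof (rule gronwall_linear[OF _ _ E_has_derivative])
    show "0 < A / K" using A K by simp
    show "0 \<le> t" using assms by simp
    fix u assume u: "0 \<le> u" "u \<le> t"
    have "E n u (Gen \<Lambda> ?h) \<le> E n u (\<lambda>q. K * mean - (A / K * ?h q - A * of_bool (card (sing q) < m)))"
    proof (rule E_mono[OF n(1) u(1)])
      fix q assume q: "q \<in> parts n"
      have "Gen \<Lambda> ?h q \<le> K * mean - of_bool (card (nons q) < K \<and> m \<le> card (sing q)) * A"
        unfolding A_def by (rule Gen_deficit_le[OF q e(1,2) m])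
      moreover have "A / K * ?h q - A * of_bool (card (sing q) < m)
          \<le> of_bool (card (nons q) < K \<and> m \<le> card (sing q)) * A"
      proof -
        have "?h q \<le> K * of_bool (card (nons q) < K)" by simp
        hence "A / K * ?h q \<le> A / K * (K * of_bool (card (nons q) < K))"
          using A K by (intro mult_left_mono) auto
        also have "\<dots> = A * of_bool (card (nons q) < K)" using K by simp
        finally show ?thesis using A by (auto simp: of_bool_def split: if_splits)
      qed
      ultimately show "Gen \<Lambda> ?h q \<le> K * mean - (A / K * ?h q - A * of_bool (card (sing q) < m))"
        by linarith
    qed
    also have "\<dots> = K * mean - (A / K * E n u ?h - A * E n u (\<lambda>q. of_bool (card (sing q) < m)))"
      using E_const[OF n(1) u(1)] by (simp only: E_diff E_cmult)
    also have "\<dots> \<le> b - A / K * E n u ?h"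
      using n(2)[OF u] A unfolding b_def by simp
    finally show "E n u (Gen \<Lambda> ?h) \<le> b - A / K * E n u ?h" .
  qed
  also have "\<dots> \<le> K * (K / (A * t)) + b / (A / K)"
  proof -
    have b: "0 \<le> b / (A / K)" using A K mean_nonneg assms by (auto simp: b_def \<epsilon>'_def)
    have "A / K * t > 0" using A K assms by simp
    hence "A / K * t \<le> exp (A / K * t)" using exp_ge_add_one_self[of "A / K * t"] by linarith
    hence "exp (- (A / K) * t) \<le> 1 / (A / K * t)"
      using \<open>A / K * t > 0\<close> le_imp_inverse_le[of "A / K * t"]
      by (simp add: exp_minus inverse_eq_divide del: times_divide_eq_left)
    moreover have "E n 0 ?h - b / (A / K) \<le> K" using b by (simp add: E_0)
    ultimately have "(E n 0 ?h - b / (A / K)) * exp (- (A / K) * t) \<le> K * (1 / (A / K * t))"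
      using K by (intro order_trans[OF mult_right_mono mult_left_mono]) auto
    thus ?thesis by (simp add: field_simps)
  qed
  also have "\<dots> = (real K ^ 2 * (1 / t + mean)) / A + \<epsilon> / 2"
    using A K assms by (simp add: b_def \<epsilon>'_def field_simps power2_eq_square)
  also have "(real K ^ 2 * (1 / t + mean)) / A \<le> \<epsilon> / 2"
  proof -
    have "2 * (real K ^ 2 * (1 / t + mean)) / \<epsilon> \<le> A" using A0 by (simp add: a0_def)
    hence "2 * (real K ^ 2 * (1 / t + mean)) \<le> A * \<epsilon>" using assms(1) by (simp only: pos_divide_le_eq)
    hence "real K ^ 2 * (1 / t + mean) \<le> A * \<epsilon> / 2" by linarith
    also have "\<dots> = (\<epsilon> / 2) * A" by simp
    finally have "real K ^ 2 * (1 / t + mean) \<le> (\<epsilon> / 2) * A" .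
    thus ?thesis using A by (simp only: pos_divide_le_eq)
  qed
  finally have "E n t ?h \<le> \<epsilon>" by simp
  moreover have "E n t (\<lambda>q. of_bool (card (nons q) < K)) \<le> E n t ?h"
    using n(1) assms by (intro E_mono) (auto simp: of_bool_def)
  ultimately show ?thesis using n(1) assms E_of_bool[of n t "\<lambda>q. card (nons q) < K"] by auto
qed

end

section \<open>Averages of exchangeable sequences\<close>

lemma averages_converge_from_cubes:
  fixes S :: "nat \<Rightarrow> real"
  assumes mono: "\<And>m n. m \<le> n \<Longrightarrow> S m \<le> S n" and nonneg: "\<And>n. 0 \<le> S n"
    and lim: "(\<lambda>k. S ((k + 1) ^ 3) / real ((k + 1) ^ 3)) \<longlonglongrightarrow> L"
  shows "(\<lambda>n. S n / real n) \<longlonglongrightarrow> L"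
proof -
  define c where "c = (\<lambda>k::nat. (k + 1) ^ 3)"
  have c: "0 < c k" "c k \<le> c (Suc k)" for k by (auto simp: c_def intro: power_mono)
  have lim: "(\<lambda>k. S (c k) / real (c k)) \<longlonglongrightarrow> L" using lim by (simp add: c_def)
  have lim': "(\<lambda>k. S (c (Suc k)) / real (c (Suc k))) \<longlonglongrightarrow> L" by (rule LIMSEQ_Suc[OF lim])
  have r: "(\<lambda>k. real (c k) / real (c (Suc k))) \<longlonglongrightarrow> 1" unfolding c_def by real_asymp
  have r': "(\<lambda>k. real (c (Suc k)) / real (c k)) \<longlonglongrightarrow> 1" unfolding c_def by real_asymp
  have lo: "(\<lambda>k. S (c k) / real (c k) * (real (c k) / real (c (Suc k)))) \<longlonglongrightarrow> L"
    using tendsto_mult[OF lim r] by simp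
  have hi: "(\<lambda>k. S (c (Suc k)) / real (c (Suc k)) * (real (c (Suc k)) / real (c k))) \<longlonglongrightarrow> L"
    using tendsto_mult[OF lim' r'] by simp
  show ?thesis
  proof (rule LIMSEQ_I)
    fix e :: real assume e: "0 < e"
    have "\<forall>\<^sub>F k in sequentially. L - e < S (c k) / real (c k) * (real (c k) / real (c (Suc k))) \<and>
        S (c (Suc k)) / real (c (Suc k)) * (real (c (Suc k)) / real (c k)) < L + e"
      using e by (intro eventually_conj order_tendstoD(1)[OF lo] order_tendstoD(2)[OF hi]) auto
    then obtain k0 where k0: "\<And>k. k0 \<le> k \<Longrightarrow> L - e < S (c k) / real (c (Suc k)) \<and> S (c (Suc k)) / real (c k) < L + e"
      using c(1) by (auto simp: eventually_sequentially less_imp_neq[THEN not_sym])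
    show "\<exists>n0. \<forall>n\<ge>n0. norm (S n / real n - L) < e"
    proof (intro exI allI impI)
      fix n assume n: "c k0 \<le> n"
      have mono_c: "mono c" using c(2) by (simp add: mono_iff_le_Suc)
      have "n < c (Suc n)" by (simp add: c_def power3_eq_cube)
      define j where "j = (LEAST j. n < c (Suc j))"
      have j1: "n < c (Suc j)" unfolding j_def by (rule LeastI) fact
      have j2: "k0 \<le> j"
      proof (rule ccontr)
        assume "\<not> k0 \<le> j"
        hence "c (Suc j) \<le> c k0" by (intro monoD[OF mono_c]) simp
        thus False using j1 n by simp
      qed
      have j3: "c j \<le> n"
      proof (cases j)
        case 0
        thus ?thesis using j2 n by simp
      next
        case (Suc i)
        hence "\<not> n < c (Suc i)" using not_less_Least[of i "\<lambda>j. n < c (Suc j)"] by (simp add: j_def)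
        thus ?thesis using Suc by simp
      qed
      have n0: "0 < n" using c(1)[of j] j3 by simp
      have "S (c j) / real (c (Suc j)) \<le> S n / real n"
        using j1 j3 n0 nonneg mono by (intro frac_le) auto
      moreover have "S n / real n \<le> S (c (Suc j)) / real (c j)"
        using j1 j3 c(1)[of j] nonneg mono by (intro frac_le) auto
      ultimately show "norm (S n / real n - L) < e" using k0[OF j2] by (auto simp: abs_less_iff)
    qed
  qed
qed

lemma (in prob_space) averages_L2:
  fixes Z :: "nat \<Rightarrow> 'a \<Rightarrow> real"
  assumes int: "\<And>j k. integrable M (\<lambda>\<omega>. Z j \<omega> * Z k \<omega>)"
    and a: "\<And>k. expectation (\<lambda>\<omega>. Z k \<omega> * Z k \<omega>) = a"
    and b: "\<forall>j k. j \<noteq> k \<longrightarrow> expectation (\<lambda>\<omega>. Z j \<omega> * Z k \<omega>) = b"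
    and mn: "0 < m" "m \<le> n"
  shows "expectation (\<lambda>\<omega>. ((\<Sum>k<m. Z k \<omega>) / real m - (\<Sum>k<n. Z k \<omega>) / real n) ^ 2) = (a - b) * (1 / real m - 1 / real n)"
    and "integrable M (\<lambda>\<omega>. ((\<Sum>k<m. Z k \<omega>) / real m - (\<Sum>k<n. Z k \<omega>) / real n) ^ 2)"
proof -
  let ?S = "\<lambda>n \<omega>. \<Sum>k<n. Z k \<omega>"
  have prod: "?S i \<omega> * ?S l \<omega> = (\<Sum>j<i. \<Sum>k<l. Z j \<omega> * Z k \<omega>)" for i l \<omega>
    by (simp add: sum_product)
  have intS: "integrable M (\<lambda>\<omega>. ?S i \<omega> * ?S l \<omega>)" for i l
    unfolding prod by (intro Bochner_Integration.integrable_sum int)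
  have ES: "expectation (\<lambda>\<omega>. ?S i \<omega> * ?S l \<omega>) = real i * (a + (real l - 1) * b)" if "i \<le> l" for i l
  proof -
    have "expectation (\<lambda>\<omega>. ?S i \<omega> * ?S l \<omega>) = (\<Sum>j<i. \<Sum>k<l. expectation (\<lambda>\<omega>. Z j \<omega> * Z k \<omega>))"
      unfolding prod by (simp add: Bochner_Integration.integral_sum int)
    also have "\<dots> = (\<Sum>j<i. a + (real l - 1) * b)"
    proof (intro sum.cong refl)
      fix j assume "j \<in> {..<i}"
      hence j: "j \<in> {..<l}" using that by auto
      have "(\<Sum>k<l. expectation (\<lambda>\<omega>. Z j \<omega> * Z k \<omega>)) = a + (\<Sum>k\<in>{..<l} - {j}. expectation (\<lambda>\<omega>. Z j \<omega> * Z k \<omega>))"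
        using j by (subst sum.remove[of _ j]) (auto simp: a)
      also have "(\<Sum>k\<in>{..<l} - {j}. expectation (\<lambda>\<omega>. Z j \<omega> * Z k \<omega>)) = (\<Sum>k\<in>{..<l} - {j}. b)"
        using b by (intro sum.cong refl) auto
      also have "\<dots> = (real l - 1) * b" using j by (simp add: card_Diff_singleton of_nat_diff)
      finally show "(\<Sum>k<l. expectation (\<lambda>\<omega>. Z j \<omega> * Z k \<omega>)) = a + (real l - 1) * b" .
    qed
    finally show ?thesis by simp
  qed
  have sq: "(?S m \<omega> / real m - ?S n \<omega> / real n) ^ 2 =
     (1 / real m ^ 2) * (?S m \<omega> * ?S m \<omega>) + (1 / real n ^ 2) * (?S n \<omega> * ?S n \<omega>)
     - (2 / (real m * real n)) * (?S m \<omega> * ?S n \<omega>)" for \<omega>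
    using mn by (simp add: power2_eq_square field_simps)
  show "integrable M (\<lambda>\<omega>. (?S m \<omega> / real m - ?S n \<omega> / real n) ^ 2)"
    unfolding sq by (intro Bochner_Integration.integrable_add Bochner_Integration.integrable_diff integrable_mult_right intS)
  have "expectation (\<lambda>\<omega>. (?S m \<omega> / real m - ?S n \<omega> / real n) ^ 2) =
     (1 / real m ^ 2) * expectation (\<lambda>\<omega>. ?S m \<omega> * ?S m \<omega>) + (1 / real n ^ 2) * expectation (\<lambda>\<omega>. ?S n \<omega> * ?S n \<omega>)
     - (2 / (real m * real n)) * expectation (\<lambda>\<omega>. ?S m \<omega> * ?S n \<omega>)"
    unfolding sq
    by (simp only: Bochner_Integration.integral_add Bochner_Integration.integral_diff integrable_mult_right intS
        Bochner_Integration.integrable_add integral_mult_right_zero)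
  also have "\<dots> = (1 / real m ^ 2) * (real m * (a + (real m - 1) * b)) + (1 / real n ^ 2) * (real n * (a + (real n - 1) * b))
     - (2 / (real m * real n)) * (real m * (a + (real n - 1) * b))"
    using mn by (simp only: ES order_refl)
  also have "\<dots> = (a - b) * (1 / real m - 1 / real n)"
    using mn by (simp add: power2_eq_square field_simps)
  finally show "expectation (\<lambda>\<omega>. (?S m \<omega> / real m - ?S n \<omega> / real n) ^ 2) = (a - b) * (1 / real m - 1 / real n)" .
qed

lemma (in prob_space) AE_averages_converge:
  fixes Z :: "nat \<Rightarrow> 'a \<Rightarrow> real"
  assumes meas [measurable]: "\<And>k. Z k \<in> borel_measurable M"
    and bound: "\<And>k \<omega>. 0 \<le> Z k \<omega>" "\<And>k \<omega>. Z k \<omega> \<le> 1"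
    and a: "\<And>k. expectation (\<lambda>\<omega>. Z k \<omega> * Z k \<omega>) = a"
    and b: "\<forall>j k. j \<noteq> k \<longrightarrow> expectation (\<lambda>\<omega>. Z j \<omega> * Z k \<omega>) = b"
  shows "AE \<omega> in M. convergent (\<lambda>n. (\<Sum>k<n. Z k \<omega>) / real n)"
proof -
  define c where "c = (\<lambda>k::nat. (k + 1) ^ 3)"
  define A where "A = (\<lambda>n \<omega>. (\<Sum>k<n. Z k \<omega>) / real n)"
  define D where "D = (\<lambda>k \<omega>. A (c k) \<omega> - A (c (Suc k)) \<omega>)"
  have [measurable]: "D k \<in> borel_measurable M" for k unfolding D_def A_def by measurable
  have int: "integrable M (\<lambda>\<omega>. Z j \<omega> * Z k \<omega>)" for j k
    using bound by (intro integrable_const_bound[where B = 1]) (auto simp: abs_mult mult_le_one)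
  have a1: "a \<le> 1"
    using integral_mono[OF int[of 0 0], of "\<lambda>_. 1"] a[of 0] bound
    by (simp add: mult_le_one prob_space)
  have b0: "0 \<le> b"
    using Bochner_Integration.integral_nonneg[of M "\<lambda>\<omega>. Z 0 \<omega> * Z 1 \<omega>"] b bound by simp
  have c: "0 < c k" "c k \<le> c (Suc k)" for k by (auto simp: c_def intro: power_mono)
  have D2: "integrable M (\<lambda>\<omega>. real (k + 1) ^ 2 * D k \<omega> ^ 2)"
    "expectation (\<lambda>\<omega>. real (k + 1) ^ 2 * D k \<omega> ^ 2) \<le> 3 * (1 / real (k + 1) ^ 2)" for k
  proof -
    show "integrable M (\<lambda>\<omega>. real (k + 1) ^ 2 * D k \<omega> ^ 2)"
      unfolding D_def A_def using averages_L2(2)[OF int a b c] by (intro integrable_mult_right)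
    have "expectation (\<lambda>\<omega>. real (k + 1) ^ 2 * D k \<omega> ^ 2) = real (k + 1) ^ 2 * ((a - b) * (1 / real (c k) - 1 / real (c (Suc k))))"
      unfolding D_def A_def using averages_L2(1)[OF int a b c] by simp
    also have "\<dots> \<le> real (k + 1) ^ 2 * (1 * (1 / real (c k) - 1 / real (c (Suc k))))"
      using a1 b0 c[of k] by (intro mult_left_mono mult_right_mono) (auto simp: frac_le)
    also have "\<dots> \<le> 3 * (1 / real (k + 1) ^ 2)"
    proof -
      define x where "x = real k + 1"
      have x: "1 \<le> x" by (simp add: x_def)
      have e: "real (c k) = x ^ 3" "real (c (Suc k)) = (x + 1) ^ 3" "real (k + 1) = x"
        by (auto simp: c_def x_def add_ac)
      have "x ^ 4 * ((x + 1) ^ 3 - x ^ 3) \<le> 3 * (x ^ 3 * (x + 1) ^ 3)"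
      proof -
        have "x * ((x + 1) ^ 3 - x ^ 3) \<le> 3 * (x + 1) ^ 3"
          using x by (simp add: power3_eq_cube algebra_simps)
        hence "x ^ 3 * (x * ((x + 1) ^ 3 - x ^ 3)) \<le> x ^ 3 * (3 * (x + 1) ^ 3)"
          using x by (intro mult_left_mono) auto
        thus ?thesis by (simp add: power3_eq_cube power4_eq_xxxx mult_ac)
      qed
      hence "x ^ 4 * ((x + 1) ^ 3 - x ^ 3) / (x ^ 3 * (x + 1) ^ 3) \<le> 3"
        using x by (subst pos_divide_le_eq) auto
      moreover have "x ^ 2 * (1 * (1 / x ^ 3 - 1 / (x + 1) ^ 3)) = x ^ 4 * ((x + 1) ^ 3 - x ^ 3) / (x ^ 3 * (x + 1) ^ 3) * (1 / x ^ 2)"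
        using x by (simp add: diff_frac_eq power2_eq_square power4_eq_xxxx)
      ultimately show ?thesis unfolding e using x by (metis mult_right_mono zero_le_divide_1_iff zero_le_power2)
    qed
    finally show "expectation (\<lambda>\<omega>. real (k + 1) ^ 2 * D k \<omega> ^ 2) \<le> 3 * (1 / real (k + 1) ^ 2)" .
  qed
  have sm: "summable (\<lambda>k. 1 / real (k + 1) ^ 2)"
    using summable_Suc_iff[of "\<lambda>k. 1 / real k ^ 2"] inverse_power_summable[of 2, where 'a = real]
    by (simp add: inverse_eq_divide)
  have "(\<integral>\<^sup>+ \<omega>. (\<Sum>k. ennreal (real (k + 1) ^ 2 * D k \<omega> ^ 2)) \<partial>M) = (\<Sum>k. \<integral>\<^sup>+ \<omega>. ennreal (real (k + 1) ^ 2 * D k \<omega> ^ 2) \<partial>M)"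
    by (rule nn_integral_suminf) measurable
  also have "\<dots> \<le> (\<Sum>k. ennreal (3 * (1 / real (k + 1) ^ 2)))"
  proof (intro suminf_le allI)
    fix k
    have "(\<integral>\<^sup>+ \<omega>. ennreal (real (k + 1) ^ 2 * D k \<omega> ^ 2) \<partial>M) = ennreal (expectation (\<lambda>\<omega>. real (k + 1) ^ 2 * D k \<omega> ^ 2))"
      by (intro nn_integral_eq_integral D2) auto
    also have "\<dots> \<le> ennreal (3 * (1 / real (k + 1) ^ 2))" by (intro ennreal_leI D2)
    finally show "(\<integral>\<^sup>+ \<omega>. ennreal (real (k + 1) ^ 2 * D k \<omega> ^ 2) \<partial>M) \<le> ennreal (3 * (1 / real (k + 1) ^ 2))" .
  qed auto
  also have "\<dots> = ennreal (\<Sum>k. 3 * (1 / real (k + 1) ^ 2))"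
    by (intro suminf_ennreal2 summable_mult sm) auto
  finally have "(\<integral>\<^sup>+ \<omega>. (\<Sum>k. ennreal (real (k + 1) ^ 2 * D k \<omega> ^ 2)) \<partial>M) \<noteq> \<infinity>"
    by (auto simp: top_unique)
  hence "AE \<omega> in M. (\<Sum>k. ennreal (real (k + 1) ^ 2 * D k \<omega> ^ 2)) \<noteq> \<infinity>"
    by (intro nn_integral_PInf_AE) measurable
  thus ?thesis
  proof eventually_elim
    case (elim \<omega>)
    hence s1: "summable (\<lambda>k. real (k + 1) ^ 2 * D k \<omega> ^ 2)"
      by (intro summable_suminf_not_top) auto
    have "summable (\<lambda>k. \<bar>D k \<omega>\<bar>)"
    proof (rule summable_comparison_test')
      show "summable (\<lambda>k. real (k + 1) ^ 2 * D k \<omega> ^ 2 + 1 / real (k + 1) ^ 2)"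
        by (intro summable_add s1 sm)
      fix k
      define x where "x = real (k + 1) * \<bar>D k \<omega>\<bar>"
      define y where "y = 1 / real (k + 1)"
      have "x * y \<le> x ^ 2 + y ^ 2"
        using sum_squares_bound[of x y] zero_le_power2[of x] zero_le_power2[of y] by linarith
      moreover have "x * y = \<bar>D k \<omega>\<bar>" by (simp add: x_def y_def)
      moreover have "x ^ 2 = real (k + 1) ^ 2 * D k \<omega> ^ 2" "y ^ 2 = 1 / real (k + 1) ^ 2"
        by (simp_all add: x_def y_def power_mult_distrib power_divide)
      ultimately show "norm \<bar>D k \<omega>\<bar> \<le> real (k + 1) ^ 2 * D k \<omega> ^ 2 + 1 / real (k + 1) ^ 2" by simp
    qed
    hence "summable (\<lambda>k. D k \<omega>)" by (rule summable_rabs_cancel)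
    then obtain s where "(\<lambda>n. \<Sum>k<n. A (c k) \<omega> - A (c (Suc k)) \<omega>) \<longlonglongrightarrow> s"
      unfolding D_def summable_def sums_def by blast
    hence "(\<lambda>n. A (c 0) \<omega> - A (c n) \<omega>) \<longlonglongrightarrow> s"
      unfolding sum_lessThan_telescope'[of "\<lambda>k. A (c k) \<omega>"] .
    from tendsto_diff[OF tendsto_const[of "A (c 0) \<omega>"] this] have "(\<lambda>n. A (c n) \<omega>) \<longlonglongrightarrow> A (c 0) \<omega> - s"
      by simp
    hence "(\<lambda>n. (\<Sum>k<n. Z k \<omega>) / real n) \<longlonglongrightarrow> A (c 0) \<omega> - s"
      unfolding A_def c_def using bound
      by (intro averages_converge_from_cubes) (auto intro!: sum_mono2 sum_nonneg)
    thus ?case by (auto simp: convergent_def)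
  qed
qed

lemma (in prob_space) AE_exchangeable_limit:
  fixes Z :: "nat \<Rightarrow> 'a \<Rightarrow> real"
  assumes meas [measurable]: "\<And>k. Z k \<in> borel_measurable M"
    and bound: "\<And>k \<omega>. 0 \<le> Z k \<omega>" "\<And>k \<omega>. Z k \<omega> \<le> 1"
    and a: "\<And>k. expectation (\<lambda>\<omega>. Z k \<omega> * Z k \<omega>) = a"
    and b: "\<forall>j k. j \<noteq> k \<longrightarrow> expectation (\<lambda>\<omega>. Z j \<omega> * Z k \<omega>) = b"
    and exch: "\<And>j k n g. j < n \<Longrightarrow> k < n \<Longrightarrow>
      expectation (\<lambda>\<omega>. Z j \<omega> * g (\<Sum>i<n. Z i \<omega>)) = expectation (\<lambda>\<omega>. Z k \<omega> * g (\<Sum>i<n. Z i \<omega>))"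
  shows "AE \<omega> in M. \<exists>L. (\<lambda>n. (\<Sum>k<n. Z k \<omega>) / real n) \<longlonglongrightarrow> L \<and> (L = 0 \<longrightarrow> (\<forall>j. Z j \<omega> = 0))"
proof -
  define S where "S = (\<lambda>n \<omega>. \<Sum>k<n. Z k \<omega>)"
  define X where "X = (\<lambda>\<omega>. lim (\<lambda>n. S n \<omega> / real n))"
  have S [measurable]: "S n \<in> borel_measurable M" for n unfolding S_def by measurable
  have X [measurable]: "X \<in> borel_measurable M" unfolding X_def by measurable
  have conv: "AE \<omega> in M. (\<lambda>n. S n \<omega> / real n) \<longlonglongrightarrow> X \<omega>"
    using AE_averages_converge[OF meas bound a b]
    unfolding X_def S_def by eventually_elim (simp add: convergent_LIMSEQ_iff)
  define \<phi> where "\<phi> = (\<lambda>(m::nat) (x::real). max 0 (min 1 (1 - real (Suc m) * x)))"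
  have \<phi>: "0 \<le> \<phi> m x" "\<phi> m x \<le> 1" "0 \<le> x \<Longrightarrow> x * \<phi> m x \<le> 1 / real (Suc m)" for m x
  proof -
    show "0 \<le> \<phi> m x" "\<phi> m x \<le> 1" by (auto simp: \<phi>_def)
    assume x: "0 \<le> x"
    show "x * \<phi> m x \<le> 1 / real (Suc m)"
    proof (cases "real (Suc m) * x \<le> 1")
      case True
      have "x * \<phi> m x \<le> x * 1" using x by (intro mult_left_mono) (auto simp: \<phi>_def)
      also have "\<dots> \<le> 1 / real (Suc m)" using True by (simp add: field_simps)
      finally show ?thesis .
    next
      case False
      thus ?thesis by (simp add: \<phi>_def)
    qed
  qed
  have [measurable]: "\<phi> m \<in> borel_measurable borel" for m unfolding \<phi>_def by measurable
  have S0: "0 \<le> S n \<omega>" for n \<omega> unfolding S_def using bound by (intro sum_nonneg) auto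
  have intZ: "integrable M (\<lambda>\<omega>. Z j \<omega> * \<phi> m (f \<omega>))" if [measurable]: "f \<in> borel_measurable M" for j m f
    using bound \<phi> by (intro integrable_const_bound[where B = 1]) (auto simp: abs_mult mult_le_one)
  have le: "expectation (\<lambda>\<omega>. Z j \<omega> * \<phi> m (S n \<omega> / real n)) \<le> 1 / real (Suc m)" if "j < n" for j m n
  proof -
    have n: "0 < real n" using that by simp
    have "real n * expectation (\<lambda>\<omega>. Z j \<omega> * \<phi> m (S n \<omega> / real n)) = (\<Sum>k<n. expectation (\<lambda>\<omega>. Z j \<omega> * \<phi> m (S n \<omega> / real n)))"
      by simp
    also have "\<dots> = (\<Sum>k<n. expectation (\<lambda>\<omega>. Z k \<omega> * \<phi> m (S n \<omega> / real n)))"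
      using exch[OF that, of _ "\<lambda>s. \<phi> m (s / real n)"] unfolding S_def by (intro sum.cong refl) auto
    also have "\<dots> = expectation (\<lambda>\<omega>. \<Sum>k<n. Z k \<omega> * \<phi> m (S n \<omega> / real n))"
      by (subst Bochner_Integration.integral_sum) (auto intro!: intZ)
    also have "\<dots> \<le> expectation (\<lambda>_. real n * (1 / real (Suc m)))"
    proof (intro integral_mono Bochner_Integration.integrable_sum intZ)
      fix \<omega>
      have "(\<Sum>k<n. Z k \<omega> * \<phi> m (S n \<omega> / real n)) = real n * (S n \<omega> / real n * \<phi> m (S n \<omega> / real n))"
        using n by (simp add: sum_distrib_right[symmetric] S_def)
      also have "\<dots> \<le> real n * (1 / real (Suc m))"
        using S0 n by (intro mult_left_mono \<phi>) auto
      finally show "(\<Sum>k<n. Z k \<omega> * \<phi> m (S n \<omega> / real n)) \<le> real n * (1 / real (Suc m))" .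
    qed auto
    also have "\<dots> = real n * (1 / real (Suc m))" by (simp add: prob_space)
    finally show ?thesis using n by (rule mult_left_le_imp_le)
  qed
  have lim: "expectation (\<lambda>\<omega>. Z j \<omega> * \<phi> m (X \<omega>)) \<le> 1 / real (Suc m)" for j m
  proof (rule tendsto_upperbound)
    show "(\<lambda>n. expectation (\<lambda>\<omega>. Z j \<omega> * \<phi> m (S n \<omega> / real n))) \<longlonglongrightarrow> expectation (\<lambda>\<omega>. Z j \<omega> * \<phi> m (X \<omega>))"
    proof (rule integral_dominated_convergence[where w = "\<lambda>_. 1"])
      show "AE \<omega> in M. (\<lambda>n. Z j \<omega> * \<phi> m (S n \<omega> / real n)) \<longlonglongrightarrow> Z j \<omega> * \<phi> m (X \<omega>)"
        using conv unfolding \<phi>_def by eventually_elim (intro tendsto_intros)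
    qed (use bound \<phi> in \<open>auto simp: abs_mult mult_le_one\<close>)
    show "\<forall>\<^sub>F n in sequentially. expectation (\<lambda>\<omega>. Z j \<omega> * \<phi> m (S n \<omega> / real n)) \<le> 1 / real (Suc m)"
      using eventually_gt_at_top[of j] by eventually_elim (rule le)
  qed auto
  have "AE \<omega> in M. Z j \<omega> * indicator {0} (X \<omega>) = 0" for j
  proof -
    have int: "integrable M (\<lambda>\<omega>. Z j \<omega> * indicator {0} (X \<omega>))"
      using bound by (intro integrable_const_bound[where B = 1]) (auto simp: abs_mult mult_le_one indicator_def)
    have "expectation (\<lambda>\<omega>. Z j \<omega> * indicator {0} (X \<omega>)) \<le> 1 / real (Suc m)" for m
    proof -
      have "expectation (\<lambda>\<omega>. Z j \<omega> * indicator {0} (X \<omega>)) \<le> expectation (\<lambda>\<omega>. Z j \<omega> * \<phi> m (X \<omega>))"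
        using bound \<phi> by (intro integral_mono int intZ mult_left_mono) (auto simp: indicator_def \<phi>_def)
      thus ?thesis using lim[of j m] by linarith
    qed
    hence "expectation (\<lambda>\<omega>. Z j \<omega> * indicator {0} (X \<omega>)) \<le> 0"
      by (intro LIMSEQ_le_const[OF lim_inverse_n'[THEN LIMSEQ_Suc]]) (auto simp: inverse_eq_divide)
    moreover have "0 \<le> expectation (\<lambda>\<omega>. Z j \<omega> * indicator {0} (X \<omega>))"
      using bound by (intro Bochner_Integration.integral_nonneg) auto
    ultimately have "expectation (\<lambda>\<omega>. Z j \<omega> * indicator {0} (X \<omega>)) = 0" by simp
    thus ?thesis using bound by (subst (asm) integral_nonneg_eq_0_iff_AE[OF int]) auto
  qed
  hence "AE \<omega> in M. \<forall>j. Z j \<omega> * indicator {0} (X \<omega>) = 0"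
    by (subst AE_all_countable) blast
  with conv show ?thesis
  proof eventually_elim
    case (elim \<omega>)
    show ?case
    proof (intro exI[of _ "X \<omega>"] conjI impI allI)
      show "(\<lambda>n. (\<Sum>k<n. Z k \<omega>) / real n) \<longlonglongrightarrow> X \<omega>" using elim(1) by (simp add: S_def)
      fix j assume "X \<omega> = 0"
      thus "Z j \<omega> = 0" using elim(2)[rule_format, of j] by simp
    qed
  qed
qed

section \<open>Exchangeability and block frequencies\<close>

definition act :: "(nat \<Rightarrow> nat) \<Rightarrow> nat set set \<Rightarrow> nat set set" where
  "act \<sigma> q = (`) \<sigma> ` q"

lemma inj_act: "inj \<sigma> \<Longrightarrow> inj (act \<sigma>)"
  unfolding act_def by (intro inj_on_image inj_onI) (auto simp: inj_image_eq_iff)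

lemma card_act: "inj \<sigma> \<Longrightarrow> card (act \<sigma> q) = card q"
  unfolding act_def by (intro card_image) (auto simp: inj_on_def inj_image_eq_iff)

lemma act_merge:
  assumes "inj \<sigma>"
  shows "act \<sigma> (merge p B) = merge (act \<sigma> p) (act \<sigma> B)"
proof -
  have "inj ((`) \<sigma>)" using assms by (auto simp: inj_on_def inj_image_eq_iff)
  hence "(`) \<sigma> ` (p - B) = (`) \<sigma> ` p - (`) \<sigma> ` B" by (rule image_set_diff)
  thus ?thesis by (simp add: act_def merge_def image_Union)
qed

lemma act_in_parts:
  assumes "\<sigma> permutes {1..n}" "p \<in> parts n"
  shows "act \<sigma> p \<in> parts n"
proof -
  have inj: "inj \<sigma>" using assms(1) by (rule permutes_inj)
  have p: "\<Union>p = {1..n}" "{} \<notin> p" "\<And>a b. a \<in> p \<Longrightarrow> b \<in> p \<Longrightarrow> a \<noteq> b \<Longrightarrow> a \<inter> b = {}"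
    using assms(2) by (auto simp: parts_def partition_on_def disjoint_def)
  have "\<Union>(act \<sigma> p) = \<sigma> ` \<Union>p" by (auto simp: act_def)
  hence "\<Union>(act \<sigma> p) = {1..n}" using p(1) permutes_image[OF assms(1)] by simp
  moreover have "{} \<notin> act \<sigma> p" using p(2) by (auto simp: act_def)
  moreover have "disjoint (act \<sigma> p)"
    unfolding disjoint_def act_def using p(3) by (auto simp: image_Int[OF inj, symmetric])
  ultimately show ?thesis by (simp add: parts_def partition_on_def)
qed

lemma bij_betw_act:
  assumes "\<sigma> permutes {1..n}"
  shows "bij_betw (act \<sigma>) (parts n) (parts n)"
proof (rule bij_betwI)
  show "act \<sigma> \<in> parts n \<rightarrow> parts n" using act_in_parts[OF assms] by auto
  show "act (inv \<sigma>) \<in> parts n \<rightarrow> parts n" using act_in_parts[OF permutes_inv[OF assms]] by auto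
  show "act (inv \<sigma>) (act \<sigma> p) = p" "act \<sigma> (act (inv \<sigma>) p) = p" for p
    by (simp_all add: act_def image_image permutes_inverses[OF assms])
qed

lemma act_singletons:
  assumes "\<sigma> permutes {1..n}"
  shows "act \<sigma> (singletons n) = singletons n"
proof -
  have s: "singletons n = (\<lambda>i. {i}) ` {1..n}" by (auto simp: singletons_def)
  have "act \<sigma> (singletons n) = (\<lambda>i. {i}) ` (\<sigma> ` {1..n})"
    unfolding act_def s by (simp add: image_image)
  thus ?thesis using permutes_image[OF assms] s by simp
qed

lemma Qoff_act:
  assumes "inj \<sigma>"
  shows "Qoff \<Lambda> (act \<sigma> p) (act \<sigma> q) = Qoff \<Lambda> p q"
proof -
  let ?S = "\<lambda>p q. {B. B \<subseteq> p \<and> card B \<ge> 2 \<and> merge p B = q}"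
  have "bij_betw (act \<sigma>) (?S p q) (?S (act \<sigma> p) (act \<sigma> q))"
  proof (rule bij_betw_imageI)
    show "inj_on (act \<sigma>) (?S p q)" using inj_act[OF assms] by (rule inj_on_subset) simp
    show "act \<sigma> ` ?S p q = ?S (act \<sigma> p) (act \<sigma> q)"
    proof (intro equalityI subsetI)
      fix C assume "C \<in> act \<sigma> ` ?S p q"
      then obtain B where "C = act \<sigma> B" "B \<subseteq> p" "card B \<ge> 2" "merge p B = q" by auto
      thus "C \<in> ?S (act \<sigma> p) (act \<sigma> q)"
        using act_merge[OF assms, of p B] card_act[OF assms, of B] by (auto simp: act_def)
    next
      fix C assume C: "C \<in> ?S (act \<sigma> p) (act \<sigma> q)"
      then obtain B where B: "C = act \<sigma> B" "B \<subseteq> p" by (auto simp: act_def subset_image_iff)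
      hence "act \<sigma> (merge p B) = act \<sigma> q" using C act_merge[OF assms, of p B] by simp
      hence "merge p B = q" using inj_act[OF assms] by (auto dest: injD)
      thus "C \<in> act \<sigma> ` ?S p q" using B C card_act[OF assms, of B] by auto
    qed
  qed
  from sum.reindex_bij_betw[OF this, of "\<lambda>B. lam \<Lambda> (card (act \<sigma> p)) (card B)"]
  show ?thesis by (simp add: Qoff_def card_act[OF assms])
qed

lemma Qgen_act:
  assumes "\<sigma> permutes {1..n}" "p \<in> parts n"
  shows "Qgen \<Lambda> n (act \<sigma> p) (act \<sigma> q) = Qgen \<Lambda> n p q"
proof -
  have inj: "inj \<sigma>" using assms(1) by (rule permutes_inj)
  have "act \<sigma> ` (parts n - {p}) = parts n - {act \<sigma> p}"
    using image_set_diff[OF inj_act[OF inj], of "parts n" "{p}"] bij_betw_imp_surj_on[OF bij_betw_act[OF assms(1)]]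
    by simp
  hence "bij_betw (act \<sigma>) (parts n - {p}) (parts n - {act \<sigma> p})"
    using inj_on_subset[OF inj_act[OF inj]] by (intro bij_betw_imageI) auto
  from sum.reindex_bij_betw[OF this, of "Qoff \<Lambda> (act \<sigma> p)"]
  have "(\<Sum>r\<in>parts n - {act \<sigma> p}. Qoff \<Lambda> (act \<sigma> p) r) = (\<Sum>r\<in>parts n - {p}. Qoff \<Lambda> p r)"
    by (simp add: Qoff_act[OF inj])
  moreover have "act \<sigma> p = act \<sigma> q \<longleftrightarrow> p = q" using inj_act[OF inj] by (auto dest: injD)
  ultimately show ?thesis by (auto simp: Qgen_def Qoff_act[OF inj])
qed

lemma Qpow_act:
  assumes "\<sigma> permutes {1..n}"
  shows "Qpow \<Lambda> n m (act \<sigma> p) (act \<sigma> q) = Qpow \<Lambda> n m p q"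
proof (induction m arbitrary: q)
  case 0
  have "act \<sigma> p = act \<sigma> q \<longleftrightarrow> p = q" using inj_act[OF permutes_inj[OF assms]] by (auto dest: injD)
  thus ?case by simp
next
  case (Suc m)
  have "Qpow \<Lambda> n (Suc m) (act \<sigma> p) (act \<sigma> q) =
     (\<Sum>r\<in>parts n. Qpow \<Lambda> n m (act \<sigma> p) (act \<sigma> r) * Qgen \<Lambda> n (act \<sigma> r) (act \<sigma> q))"
    by (simp add: sum.reindex_bij_betw[OF bij_betw_act[OF assms], 
        where g = "\<lambda>r. Qpow \<Lambda> n m (act \<sigma> p) r * Qgen \<Lambda> n r (act \<sigma> q)"])
  also have "\<dots> = Qpow \<Lambda> n (Suc m) p q"
    by (simp add: Suc.IH Qgen_act[OF assms])
  finally show ?case .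
qed

lemma Ptrans_act:
  "\<sigma> permutes {1..n} \<Longrightarrow> Ptrans \<Lambda> n t (act \<sigma> p) (act \<sigma> q) = Ptrans \<Lambda> n t p q"
  by (simp add: Ptrans_def Qpow_act)

definition conn :: "nat \<Rightarrow> nat \<Rightarrow> nat set set \<Rightarrow> real" where
  "conn i j q = of_bool (\<exists>b\<in>q. i \<in> b \<and> j \<in> b)"

lemma conn_act: "inj \<sigma> \<Longrightarrow> conn (\<sigma> i) (\<sigma> j) (act \<sigma> q) = conn i j q"
  by (auto simp: conn_def act_def inj_image_mem_iff)

lemma conn_iota: "i \<in> {1..n} \<Longrightarrow> j \<in> {1..n} \<Longrightarrow> conn i j (iota n P) = conn i j P"
proof -
  assume ij: "i \<in> {1..n}" "j \<in> {1..n}"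
  have "(\<exists>b\<in>iota n P. i \<in> b \<and> j \<in> b) \<longleftrightarrow> (\<exists>b\<in>P. i \<in> b \<and> j \<in> b)"
  proof
    assume "\<exists>b\<in>P. i \<in> b \<and> j \<in> b"
    then obtain b where "b \<in> P" "i \<in> b" "j \<in> b" by blast
    hence m: "b \<inter> {1..n} \<in> iota n P" and "i \<in> b \<inter> {1..n} \<and> j \<in> b \<inter> {1..n}"
      unfolding iota_def using ij by blast+
    thus "\<exists>b\<in>iota n P. i \<in> b \<and> j \<in> b" by (intro bexI[OF _ m])
  qed (auto simp: iota_def)
  thus ?thesis by (simp add: conn_def)
qed

text \<open>\<open>skip i\<close> enumerates the positive integers other than \<open>i\<close>.\<close>

definition skip :: "nat \<Rightarrow> nat \<Rightarrow> nat" where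
  "skip i k = (if k + 1 < i then k + 1 else k + 2)"

lemma inj_skip: "inj (skip i)"
  by (auto simp: inj_def skip_def split: if_splits)

lemma skip_image:
  assumes "1 \<le> i" "i \<le> n + 1"
  shows "skip i ` {..<n} = {1..n + 1} - {i}"
proof (intro equalityI subsetI)
  fix j assume j: "j \<in> {1..n + 1} - {i}"
  show "j \<in> skip i ` {..<n}"
  proof (cases "j < i")
    case True
    hence "j = skip i (j - 1)" "j - 1 < n" using j assms by (auto simp: skip_def)
    thus ?thesis by blast
  next
    case False
    hence "j = skip i (j - 2)" "j - 2 < n" using j assms by (auto simp: skip_def)
    thus ?thesis by blast
  qed
qed (use assms in \<open>auto simp: skip_def split: if_splits\<close>)

lemma skip_bounds: "1 \<le> skip i k" "skip i k \<le> k + 2" "1 \<le> i \<Longrightarrow> skip i k \<noteq> i"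
  by (auto simp: skip_def)

lemma transpose_skip:
  "Transposition.transpose (skip i j) (skip i j') (skip i k) = skip i (Transposition.transpose j j' k)"
  using injD[OF inj_skip[of i]] by (auto simp: Transposition.transpose_def)

lemma conn_block:
  assumes "partition_on A P" "b \<in> P" "i \<in> b"
  shows "conn i j P = of_bool (j \<in> b)"
  using assms unfolding conn_def partition_on_def disjoint_def by (intro arg_cong[where f = of_bool]) auto

lemma card_block_eq:
  assumes "partition_on {1..} P" "b \<in> P" "i \<in> b" "i \<le> n + 1"
  shows "real (card (b \<inter> {1..n + 1})) = 1 + (\<Sum>k<n. conn i (skip i k) P)"
proof -
  have i: "1 \<le> i" using assms(1-3) by (auto simp: partition_on_def)
  have "(\<Sum>k<n. conn i (skip i k) P) = (\<Sum>j\<in>{1..n + 1} - {i}. of_bool (j \<in> b))"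
    unfolding skip_image[OF i assms(4), symmetric] conn_block[OF assms(1-3)]
    by (subst sum.reindex) (auto intro: inj_on_subset[OF inj_skip])
  also have "\<dots> = real (card (({1..n + 1} - {i}) \<inter> b))"
    by (simp add: Int_def)
  finally have 1: "(\<Sum>k<n. conn i (skip i k) P) = real (card (({1..n + 1} - {i}) \<inter> b))" .
  have "b \<inter> {1..n + 1} = insert i (({1..n + 1} - {i}) \<inter> b)" using i assms(3,4) by auto
  hence "card (b \<inter> {1..n + 1}) = Suc (card (({1..n + 1} - {i}) \<inter> b))" by simp
  thus ?thesis using 1 by simp
qed

lemma block_frequency:
  assumes "partition_on {1..} P" "b \<in> P" "i \<in> b"
    and lim: "(\<lambda>n. (\<Sum>k<n. conn i (skip i k) P) / real n) \<longlonglongrightarrow> L"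
  shows "(\<lambda>k. real (card (b \<inter> {1..k})) / real k) \<longlonglongrightarrow> L"
proof (rule LIMSEQ_imp_Suc)
  let ?S = "\<lambda>n. \<Sum>k<n. conn i (skip i k) P"
  have "(\<lambda>n. 1 / real (Suc n) + ?S n / real n * (real n / real (Suc n))) \<longlonglongrightarrow> 0 + L * 1"
    by (intro tendsto_add tendsto_mult lim) real_asymp+
  moreover have "\<forall>\<^sub>F n in sequentially. 1 / real (Suc n) + ?S n / real n * (real n / real (Suc n))
      = real (card (b \<inter> {1..Suc n})) / real (Suc n)"
    using eventually_ge_at_top[of i]  eventually_gt_at_top[of 0]
  proof eventually_elim
    case (elim n)
    thus ?case using card_block_eq[OF assms(1-3), of n] by (simp add: add_divide_distrib)
  qed
  ultimately show "(\<lambda>n. real (card (b \<inter> {1..Suc n})) / real (Suc n)) \<longlonglongrightarrow> L"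
    using Lim_transform_eventually by fastforce
qed

lemma infinite_positive_frequency_blocks:
  assumes P: "partition_on {1..} P"
    and lim: "\<And>i. 1 \<le> i \<Longrightarrow> \<exists>L. (\<lambda>n. (\<Sum>k<n. conn i (skip i k) P) / real n) \<longlonglongrightarrow> L \<and>
       (L = 0 \<longrightarrow> (\<forall>k. conn i (skip i k) P = 0))"
    and many: "\<And>K. \<exists>n. K \<le> card (nons (iota n P))"
  shows "infinite {b \<in> P. has_pos_freq b}"
proof
  let ?F = "{b \<in> P. has_pos_freq b}"
  assume fin: "finite ?F"
  have pos: "has_pos_freq b" if b: "b \<in> P" "i \<in> b" "j \<in> b" "i \<noteq> j" for b i j
  proof -
    have ij: "1 \<le> i" "1 \<le> j" using b P by (auto simp: partition_on_def)
    obtain L where L: "(\<lambda>n. (\<Sum>k<n. conn i (skip i k) P) / real n) \<longlonglongrightarrow> L"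
      "L = 0 \<longrightarrow> (\<forall>k. conn i (skip i k) P = 0)" using lim[OF ij(1)] by blast
    have "0 \<le> L"
      by (rule LIMSEQ_le_const[OF L(1)]) (auto simp: conn_def intro!: sum_nonneg divide_nonneg_nonneg)
    moreover have "L \<noteq> 0"
    proof
      assume "L = 0"
      moreover have "j \<in> skip i ` {..<i + j}"
        using ij b by (subst skip_image) auto
      ultimately have "conn i j P = 0" using L(2) by auto
      thus False using conn_block[OF P b(1,2), of j] b by simp
    qed
    ultimately show ?thesis
      unfolding has_pos_freq_def using block_frequency[OF P b(1,2) L(1)] by (intro exI[of _ L]) auto
  qed
  obtain n where n: "Suc (card ?F) \<le> card (nons (iota n P))" using many by blast
  have "nons (iota n P) \<subseteq> (\<lambda>b. b \<inter> {1..n}) ` ?F"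
  proof
    fix c assume "c \<in> nons (iota n P)"
    then obtain b where b: "c = b \<inter> {1..n}" "b \<in> P" "c \<noteq> {}" "card c \<noteq> 1"
      by (auto simp: nons_def iota_def)
    from b(3) obtain i where i: "i \<in> c" by auto
    have "c \<noteq> {i}" using b(4) by auto
    then obtain j where "j \<in> c" "j \<noteq> i" using i by auto
    hence "has_pos_freq b" using pos[of b i j] b i by auto
    thus "c \<in> (\<lambda>b. b \<inter> {1..n}) ` ?F" using b by auto
  qed
  hence "card (nons (iota n P)) \<le> card ?F" by (rule surj_card_le[OF fin])
  thus False using n by simp
qed

context dust_coalescent
begin

lemma E_act:
  assumes "\<sigma> permutes {1..n}"
  shows "E n u (\<lambda>q. f (act \<sigma> q)) = E n u f"
proof -
  have "E n u f = (\<Sum>q\<in>parts n. Ptrans \<Lambda> n u (singletons n) (act \<sigma> q) * f (act \<sigma> q))"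
    unfolding E_def by (rule sum.reindex_bij_betw[OF bij_betw_act[OF assms], symmetric])
  also have "\<dots> = (\<Sum>q\<in>parts n. Ptrans \<Lambda> n u (singletons n) q * f (act \<sigma> q))"
    using Ptrans_act[OF assms, of \<Lambda> u "singletons n"] by (simp add: act_singletons[OF assms])
  finally show ?thesis by (simp add: E_def)
qed

lemma expectation_iota:
  fixes f :: "nat set set \<Rightarrow> real"
  assumes "1 \<le> n" "0 \<le> u"
  shows "M.expectation (\<lambda>\<omega>. f (iota n (Pt u \<omega>))) = E n u f"
proof -
  let ?A = "\<lambda>q. {\<omega> \<in> space M. iota n (Pt u \<omega>) = q}"
  have "M.expectation (\<lambda>\<omega>. f (iota n (Pt u \<omega>))) = M.expectation (\<lambda>\<omega>. \<Sum>q\<in>parts n. indicator (?A q) \<omega> * f q)"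
  proof (rule Bochner_Integration.integral_cong[OF refl])
    fix \<omega> assume \<omega>: "\<omega> \<in> space M"
    have "(\<Sum>q\<in>parts n. indicator (?A q) \<omega> * f q) = (\<Sum>q\<in>parts n. if iota n (Pt u \<omega>) = q then f q else 0)"
      using \<omega> by (intro sum.cong) auto
    thus "f (iota n (Pt u \<omega>)) = (\<Sum>q\<in>parts n. indicator (?A q) \<omega> * f q)"
      using iota_in_parts[OF partition_Pt[OF assms(2) \<omega>], of n] by (simp add: finite_parts)
  qed
  also have "\<dots> = (\<Sum>q\<in>parts n. M.expectation (\<lambda>\<omega>. indicator (?A q) \<omega> * f q))"
    using sets_iota[OF assms]
    by (intro Bochner_Integration.integral_sum integrable_mult_left) (auto simp: M.emeasure_eq_measure)
  also have "\<dots> = E n u f"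
    using sets_iota[OF assms] by (simp add: E_def prob_iota_eq[OF assms])
  finally show ?thesis .
qed

lemma expectation_swap:
  fixes F :: "(nat \<Rightarrow> real) \<Rightarrow> real"
  assumes "0 \<le> t" "1 \<le> i" "j < n" "j' < n"
    and F: "\<And>x y. (\<And>k. k < n \<Longrightarrow> x k = y k) \<Longrightarrow> F x = F y"
  shows "M.expectation (\<lambda>\<omega>. F (\<lambda>k. conn i (skip i k) (Pt t \<omega>))) =
    M.expectation (\<lambda>\<omega>. F (\<lambda>k. conn i (skip i (Transposition.transpose j j' k)) (Pt t \<omega>)))"
proof -
  define N where "N = n + 1 + i"
  define \<tau> where "\<tau> = Transposition.transpose (skip i j) (skip i j')"
  have N: "1 \<le> N" by (simp add: N_def)
  have r: "i \<in> {1..N}" "k < n \<Longrightarrow> skip i k \<in> {1..N}" for k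
    using skip_bounds[of i k] assms(2) by (auto simp: N_def)
  have \<tau>: "\<tau> permutes {1..N}" unfolding \<tau>_def by (intro permutes_swap_id r assms)
  have \<tau>i: "\<tau> i = i" unfolding \<tau>_def using skip_bounds(3)[OF assms(2)]
    by (metis transpose_apply_other)
  have conn: "conn i (skip i k) (act \<tau> q) = conn i (skip i (Transposition.transpose j j' k)) q" for k q
  proof -
    have "\<tau> (skip i (Transposition.transpose j j' k)) = skip i k"
      unfolding \<tau>_def transpose_skip by simp
    thus ?thesis using conn_act[OF permutes_inj[OF \<tau>], of i "skip i (Transposition.transpose j j' k)" q] \<tau>i by simp
  qed
  have tr: "Transposition.transpose j j' k < n" if "k < n" for k
    using that assms by (auto simp: Transposition.transpose_def)
  have "M.expectation (\<lambda>\<omega>. F (\<lambda>k. conn i (skip i k) (Pt t \<omega>))) =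
      M.expectation (\<lambda>\<omega>. F (\<lambda>k. conn i (skip i k) (iota N (Pt t \<omega>))))"
    by (intro Bochner_Integration.integral_cong refl F conn_iota[symmetric] r)
  also have "\<dots> = E N t (\<lambda>q. F (\<lambda>k. conn i (skip i k) q))"
    by (rule expectation_iota[OF N assms(1)])
  also have "\<dots> = E N t (\<lambda>q. F (\<lambda>k. conn i (skip i k) (act \<tau> q)))"
    by (rule E_act[OF \<tau>, symmetric])
  also have "\<dots> = M.expectation (\<lambda>\<omega>. F (\<lambda>k. conn i (skip i (Transposition.transpose j j' k)) (iota N (Pt t \<omega>))))"
    unfolding conn by (rule expectation_iota[OF N assms(1), symmetric])
  also have "\<dots> = M.expectation (\<lambda>\<omega>. F (\<lambda>k. conn i (skip i (Transposition.transpose j j' k)) (Pt t \<omega>)))"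
    by (intro Bochner_Integration.integral_cong refl F conn_iota r tr)
  finally show ?thesis .
qed

lemma AE_block_limit:
  assumes "0 \<le> t" "1 \<le> i"
  shows "AE \<omega> in M. \<exists>L. (\<lambda>n. (\<Sum>k<n. conn i (skip i k) (Pt t \<omega>)) / real n) \<longlonglongrightarrow> L \<and>
    (L = 0 \<longrightarrow> (\<forall>k. conn i (skip i k) (Pt t \<omega>) = 0))"
proof -
  define Z where "Z = (\<lambda>k \<omega>. conn i (skip i k) (Pt t \<omega>))"
  have swap: "M.expectation (\<lambda>\<omega>. F (\<lambda>k. Z k \<omega>)) =
      M.expectation (\<lambda>\<omega>. F (\<lambda>k. Z (Transposition.transpose j j' k) \<omega>))"
    if "j < n" "j' < n" "\<And>x y. (\<And>k. k < n \<Longrightarrow> x k = y k) \<Longrightarrow> F x = F y"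
    for j j' n and F :: "(nat \<Rightarrow> real) \<Rightarrow> real"
    unfolding Z_def by (rule expectation_swap[OF assms that])
  have meas: "Z k \<in> borel_measurable M" for k
  proof -
    define N where "N = k + 2 + i"
    have "Z k = (\<lambda>\<omega>. conn i (skip i k) (iota N (Pt t \<omega>)))"
      unfolding Z_def using skip_bounds[of i k] assms(2)
      by (intro ext conn_iota[symmetric]) (auto simp: N_def)
    moreover have "(\<lambda>\<omega>. conn i (skip i k) (iota N (Pt t \<omega>))) \<in> borel_measurable M"
      by (rule measurable_compose[OF measurable_iota]) (use assms in \<open>auto simp: N_def\<close>)
    ultimately show ?thesis by simp
  qed
  have bound: "0 \<le> Z k \<omega>" "Z k \<omega> \<le> 1" for k \<omega> by (auto simp: Z_def conn_def)
  have a: "M.expectation (\<lambda>\<omega>. Z k \<omega> * Z k \<omega>) = M.expectation (\<lambda>\<omega>. Z 0 \<omega> * Z 0 \<omega>)" for k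
    using swap[of k "Suc k" 0 "\<lambda>x. x k * x k"] by simp
  have b1: "M.expectation (\<lambda>\<omega>. Z j \<omega> * Z k \<omega>) = M.expectation (\<lambda>\<omega>. Z j' \<omega> * Z k \<omega>)" if "j \<noteq> k" "j' \<noteq> k" for j j' k
    using swap[of j "Suc (max k (max j j'))" j' "\<lambda>x. x j * x k"] that by (simp add: less_Suc_eq_le)
  have b: "M.expectation (\<lambda>\<omega>. Z j \<omega> * Z k \<omega>) = M.expectation (\<lambda>\<omega>. Z 0 \<omega> * Z 1 \<omega>)" if "j \<noteq> k" for j k
  proof -
    have comm: "M.expectation (\<lambda>\<omega>. Z j \<omega> * Z k \<omega>) = M.expectation (\<lambda>\<omega>. Z k \<omega> * Z j \<omega>)" for j k
      by (simp only: mult.commute)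
    have *: "M.expectation (\<lambda>\<omega>. Z 0 \<omega> * Z k \<omega>) = M.expectation (\<lambda>\<omega>. Z 0 \<omega> * Z 1 \<omega>)" if "k \<noteq> 0" for k
      using b1[of k 0 1] that comm[of k 0] comm[of 1 0] by simp
    show ?thesis
    proof (cases "k = 0")
      case True
      hence "j \<noteq> 0" using that by simp
      show ?thesis unfolding True comm[of j 0] by (rule *) fact
    next
      case False
      have "M.expectation (\<lambda>\<omega>. Z j \<omega> * Z k \<omega>) = M.expectation (\<lambda>\<omega>. Z 0 \<omega> * Z k \<omega>)"
        by (rule b1) (use that False in auto)
      also have "\<dots> = M.expectation (\<lambda>\<omega>. Z 0 \<omega> * Z 1 \<omega>)" by (rule *) fact
      finally show ?thesis .
    qed
  qed
  have "AE \<omega> in M. \<exists>L. (\<lambda>n. (\<Sum>k<n. Z k \<omega>) / real n) \<longlonglongrightarrow> L \<and> (L = 0 \<longrightarrow> (\<forall>j. Z j \<omega> = 0))"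
  proof (rule M.AE_exchangeable_limit)
    show "\<forall>j k. j \<noteq> k \<longrightarrow> M.expectation (\<lambda>\<omega>. Z j \<omega> * Z k \<omega>) = M.expectation (\<lambda>\<omega>. Z 0 \<omega> * Z 1 \<omega>)"
      using b by blast
    fix j k n :: nat and g :: "real \<Rightarrow> real" assume jk: "j < n" "k < n"
    have "(\<Sum>l<n. Z (Transposition.transpose j k l) \<omega>) = (\<Sum>l<n. Z l \<omega>)" for \<omega>
      using sum.permute[OF permutes_swap_id, of j "{..<n}" k "\<lambda>l. Z l \<omega>"] jk by (simp add: comp_def)
    moreover have "M.expectation (\<lambda>\<omega>. Z j \<omega> * g (\<Sum>i<n. Z i \<omega>)) =
        M.expectation (\<lambda>\<omega>. Z (Transposition.transpose j k j) \<omega> * g (\<Sum>l<n. Z (Transposition.transpose j k l) \<omega>))"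
    proof (rule swap[OF jk, of "\<lambda>x. x j * g (\<Sum>l<n. x l)"])
      fix x y :: "nat \<Rightarrow> real" assume xy: "\<And>k. k < n \<Longrightarrow> x k = y k"
      hence "(\<Sum>l<n. x l) = (\<Sum>l<n. y l)" by (intro sum.cong) auto
      thus "x j * g (\<Sum>l<n. x l) = y j * g (\<Sum>l<n. y l)" using xy jk by simp
    qed
    ultimately show "M.expectation (\<lambda>\<omega>. Z j \<omega> * g (\<Sum>i<n. Z i \<omega>)) = M.expectation (\<lambda>\<omega>. Z k \<omega> * g (\<Sum>i<n. Z i \<omega>))"
      by simp
  qed (fact meas bound a)+
  thus ?thesis by (simp add: Z_def)
qed

lemma AE_many_nonsingletons:
  assumes "0 < t"
  shows "AE \<omega> in M. \<exists>n. K \<le> card (nons (iota n (Pt t \<omega>)))"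
proof -
  let ?B = "\<lambda>n. {\<omega> \<in> space M. card (nons (iota n (Pt t \<omega>))) < K}"
  let ?Bad = "\<Inter>n\<in>{1..}. ?B n"
  have B: "?B n \<in> sets M" if "1 \<le> n" for n using sets_iota[OF that, of t] assms by simp
  have Bad: "?Bad \<in> sets M" using B by (intro sets.countable_INT') auto
  have "M.prob ?Bad \<le> 0"
  proof (rule field_le_epsilon)
    fix e :: real assume "0 < e"
    then obtain n where n: "1 \<le> n" "M.prob (?B n) \<le> e"
      using few_nonsingletons_unlikely[of e t K] assms by auto
    have "M.prob ?Bad \<le> M.prob (?B n)" using n(1) B by (intro M.finite_measure_mono) auto
    thus "M.prob ?Bad \<le> 0 + e" using n by simp
  qed
  hence "emeasure M ?Bad = 0" by (simp add: M.emeasure_eq_measure measure_le_0_iff)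
  hence null: "?Bad \<in> null_sets M" using Bad by auto
  show ?thesis by (rule AE_I'[OF null]) (auto simp: not_le)
qed

lemma AE_infinite_positive_frequency_blocks:
  assumes "0 < t"
  shows "AE \<omega> in M. infinite {b \<in> Pt t \<omega>. has_pos_freq b}"
proof -
  have "AE \<omega> in M. \<forall>i\<in>{1..}. \<exists>L. (\<lambda>n. (\<Sum>k<n. conn i (skip i k) (Pt t \<omega>)) / real n) \<longlonglongrightarrow> L \<and>
      (L = 0 \<longrightarrow> (\<forall>k. conn i (skip i k) (Pt t \<omega>) = 0))"
    using AE_block_limit[of t] assms by (subst AE_ball_countable) auto
  moreover have "AE \<omega> in M. \<forall>K. \<exists>n. K \<le> card (nons (iota n (Pt t \<omega>)))"
    using AE_many_nonsingletons[OF assms] by (subst AE_all_countable) auto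
  ultimately show ?thesis using AE_space[of M]
  proof eventually_elim
    case (elim \<omega>)
    show ?case
      by (rule infinite_positive_frequency_blocks[OF partition_Pt]) (use elim assms in auto)
  qed
qed

end

theorem theorem5:
  fixes \<Lambda> :: "real measure" and M :: "'a measure" and Pt :: "real \<Rightarrow> 'a \<Rightarrow> nat set set" and t :: real
  assumes "finite_measure \<Lambda>" and "sets \<Lambda> = sets borel"
    and "emeasure \<Lambda> (UNIV - {0..1}) = 0"
    and "emeasure \<Lambda> {1} = 0"
    and "emeasure (nu \<Lambda>) {0, 1} = 0"
    and "(\<integral>\<^sup>+ x. ennreal x \<partial>nu \<Lambda>) < \<infinity>"
    and "emeasure (nu \<Lambda>) {0..1} = \<infinity>"
    and "prob_space M"
    and "is_Lambda_coalescent \<Lambda> M Pt"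
    and "t > 0"
  shows "AE \<omega> in M. Na Pt t \<omega> = \<infinity>"
proof -
  interpret dust_measure \<Lambda>
    using assms by (intro dust_measure.intro) auto
  interpret dust_coalescent \<Lambda> M Pt
    using assms by (intro dust_coalescent.intro dust_coalescent_axioms.intro dust_measure_axioms) auto
  show ?thesis
    using AE_infinite_positive_frequency_blocks[OF assms(10)] by eventually_elim (simp add: Na_def)
qed

end
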